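(* There exist universal constants $C>0$ and $p>0$ such that the following holds. Let $1\le r\le d$ be integers, $a$ a positive integer, $\alpha>0$ and $\varepsilon\in(0,1)$. There is a query algorithm (depending only on $d,r,a,\alpha,\varepsilon$) such that, for every rank-$r$ projector state $\rho=\Pi_r/r$ on $\mathbb{C}^d$ ($\Pi_r$ an orthogonal projector of rank $r$) and every $(\alpha,a,0)$-block encoding $U_\rho$ of $\rho$, the algorithm makes at most $C\,\alpha\sqrt{rd}$ queries in total to $\mathcal{U}_\rho$ and $\mathcal{U}_\rho^\dagger$ and, with success probability at least $p$, outputs a state $\hat\rho$ satisfying $\|\hat\rho-\rho\|_1\le\varepsilon$.
   Context: Block encoding: a unitary $U$ on $(\mathbb{C}^2)^{\otimes a}\otimes\mathbb{C}^d$ is an $(\alpha,a,0)$-block encoding of an operator $A$ on $\mathbb{C}^d$ if $\alpha(\langle 0|^{\otimes a}\otimes I)U(|0\rangle^{\otimes a}\otimes I)=A$. For a unitary $U_\rho$, put $\mathcal{U}_\rho(\cdot)=U_\rho(\cdot)U_\rho^\dagger$ and $\mathcal{U}_\rho^\dagger(\cdot)=U_\rho^\dagger(\cdot)U_\rho$. $\|\cdot\|_1$ is the trace norm. A query algorithm prepares a fixed initial state on a finite-dimensional workspace, applies a sequence of fixed unitary channels (independent of the unknown $\rho$ and $U_\rho$) interleaved with uses (queries) of $\mathcal{U}_\rho$ and $\mathcal{U}_\rho^\dagger$, performs a fixed measurement on part of the workspace with a binary outcome success/failure, and outputs the state of a designated $d$-dimensional subsystem. "With success probability at least $p$ outputs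 $\hat\rho$" means the outcome "success" occurs with probability at least $p$ and, conditioned on it, the output state is $\hat\rho$. *)

theory Defs
  imports "Jordan_Normal_Form.Schur_Decomposition" "Jordan_Normal_Form.DL_Rank"
begin

text \<open>
  Operators on \<open>\<complex>\<^sup>n\<close> are complex \<open>n \<times> n\<close> matrices. The index pair \<open>(i, k)\<close> of
  \<open>\<complex>\<^sup>n \<otimes> \<complex>\<^sup>m\<close> is encoded as \<open>i * m + k\<close>, so that iterated Kronecker products are
  strictly associative.
\<close>

definition kron :: "complex mat \<Rightarrow> complex mat \<Rightarrow> complex mat" where
  "kron A B = mat (dim_row A * dim_row B) (dim_col A * dim_col B)
     (\<lambda>(i, j). A $$ (i div dim_row B, j div dim_col B) * B $$ (i mod dim_row B, j mod dim_col B))"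

definition tr :: "complex mat \<Rightarrow> complex" where
  "tr A = (\<Sum>i<dim_row A. A $$ (i, i))"

text \<open>The partial trace over the first factor of \<open>\<complex>\<^sup>n \<otimes> \<complex>\<^sup>m\<close>.\<close>

definition partial_trace :: "nat \<Rightarrow> nat \<Rightarrow> complex mat \<Rightarrow> complex mat" where
  "partial_trace n m A = mat m m (\<lambda>(i, j). \<Sum>k<n. A $$ (k * m + i, k * m + j))"

text \<open>
  The sum of the singular values of \<open>A\<close>: the square roots of the eigenvalues of \<open>A\<^sup>\<dagger> A\<close>
  (which are real and nonnegative), counted with algebraic multiplicity.
\<close>

definition trace_norm :: "complex mat \<Rightarrow> real" where
  "trace_norm A = (\<Sum>x\<in>#proots (char_poly (mat_adjoint A * A)). sqrt (Re x))"

definition unitary_mat :: "nat \<Rightarrow> complex mat \<Rightarrow> bool" where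
  "unitary_mat n U \<longleftrightarrow> U \<in> carrier_mat n n \<and> mat_adjoint U * U = 1\<^sub>m n \<and> U * mat_adjoint U = 1\<^sub>m n"

text \<open>In the order on \<^typ>\<open>complex\<close>, \<open>0 \<le> z\<close> says that \<open>z\<close> is real and nonnegative.\<close>

definition density_operator :: "nat \<Rightarrow> complex mat \<Rightarrow> bool" where
  "density_operator n \<sigma> \<longleftrightarrow> \<sigma> \<in> carrier_mat n n \<and> mat_adjoint \<sigma> = \<sigma> \<and>
     (\<forall>v\<in>carrier_vec n. 0 \<le> (\<sigma> *\<^sub>v v) \<bullet>c v) \<and> tr \<sigma> = 1"

definition projector :: "nat \<Rightarrow> nat \<Rightarrow> complex mat \<Rightarrow> bool" where
  "projector d r P \<longleftrightarrow> P \<in> carrier_mat d d \<and> mat_adjoint P = P \<and> P * P = P \<and> vec_space.rank d P = r"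

text \<open>The column vector \<open>|0\<rangle>\<^sup>\<otimes>\<^sup>a\<close>, as a \<open>2\<^sup>a \<times> 1\<close> matrix.\<close>

primrec ket_zero :: "nat \<Rightarrow> complex mat" where
  "ket_zero 0 = 1\<^sub>m 1"
| "ket_zero (Suc a) = kron (mat_of_cols 2 [unit_vec 2 0]) (ket_zero a)"

definition block_encoding :: "nat \<Rightarrow> real \<Rightarrow> nat \<Rightarrow> complex mat \<Rightarrow> complex mat \<Rightarrow> bool" where
  "block_encoding d \<alpha> a A U \<longleftrightarrow> unitary_mat (2 ^ a * d) U \<and>
     complex_of_real \<alpha> \<cdot>\<^sub>m
       (kron (mat_adjoint (ket_zero a)) (1\<^sub>m d) * U * kron (ket_zero a) (1\<^sub>m d)) = A"

definition unitary_channel :: "complex mat \<Rightarrow> complex mat \<Rightarrow> complex mat" where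
  "unitary_channel U \<sigma> = U * \<sigma> * mat_adjoint U"

text \<open>
  A query algorithm works on \<open>\<complex>\<^sup>w \<otimes> (\<complex>\<^sup>2)\<^sup>\<otimes>\<^sup>a \<otimes> \<complex>\<^sup>d\<close>, where \<open>w\<close> is the dimension of
  the reference system. Queries act on the factor \<open>(\<complex>\<^sup>2)\<^sup>\<otimes>\<^sup>a \<otimes> \<complex>\<^sup>d\<close>, the final measurement
  on \<open>\<complex>\<^sup>w \<otimes> (\<complex>\<^sup>2)\<^sup>\<otimes>\<^sup>a\<close>, and the output is the last factor \<open>\<complex>\<^sup>d\<close>. Fixing these positions is
  no restriction, because the fixed unitaries can permute subsystems and write the
  measured information to \<open>\<complex>\<^sup>w\<close>. The measurement is given by two measurement operators,
  satisfying the completeness relation.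
\<close>

datatype instruction = Fixed_Unitary "complex mat" | Query | Query_Adjoint

record query_algorithm =
  ref_dim :: nat
  init_state :: "complex mat"
  program :: "instruction list"
  meas_success :: "complex mat"
  meas_failure :: "complex mat"

definition wf_algorithm :: "nat \<Rightarrow> nat \<Rightarrow> query_algorithm \<Rightarrow> bool" where
  "wf_algorithm d a alg \<longleftrightarrow>
     0 < ref_dim alg \<and>
     density_operator (ref_dim alg * 2 ^ a * d) (init_state alg) \<and>
     (\<forall>V. Fixed_Unitary V \<in> set (program alg) \<longrightarrow> unitary_mat (ref_dim alg * 2 ^ a * d) V) \<and>
     meas_success alg \<in> carrier_mat (ref_dim alg * 2 ^ a) (ref_dim alg * 2 ^ a) \<and>
     meas_failure alg \<in> carrier_mat (ref_dim alg * 2 ^ a) (ref_dim alg * 2 ^ a) \<and>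
     mat_adjoint (meas_success alg) * meas_success alg
       + mat_adjoint (meas_failure alg) * meas_failure alg = 1\<^sub>m (ref_dim alg * 2 ^ a)"

definition num_queries :: "query_algorithm \<Rightarrow> nat" where
  "num_queries alg = length (filter (\<lambda>i. i = Query \<or> i = Query_Adjoint) (program alg))"

fun exec_instruction :: "nat \<Rightarrow> complex mat \<Rightarrow> instruction \<Rightarrow> complex mat \<Rightarrow> complex mat" where
  "exec_instruction w U (Fixed_Unitary V) \<sigma> = unitary_channel V \<sigma>"
| "exec_instruction w U Query \<sigma> = unitary_channel (kron (1\<^sub>m w) U) \<sigma>"
| "exec_instruction w U Query_Adjoint \<sigma> = unitary_channel (kron (1\<^sub>m w) (mat_adjoint U)) \<sigma>"

definition final_state :: "query_algorithm \<Rightarrow> complex mat \<Rightarrow> complex mat" where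
  "final_state alg U = fold (exec_instruction (ref_dim alg) U) (program alg) (init_state alg)"

text \<open>The unnormalised state after the outcome ``success''; its trace is the success probability.\<close>

definition success_branch :: "nat \<Rightarrow> query_algorithm \<Rightarrow> complex mat \<Rightarrow> complex mat" where
  "success_branch d alg U =
     kron (meas_success alg) (1\<^sub>m d) * final_state alg U * mat_adjoint (kron (meas_success alg) (1\<^sub>m d))"

definition success_prob :: "nat \<Rightarrow> query_algorithm \<Rightarrow> complex mat \<Rightarrow> real" where
  "success_prob d alg U = Re (tr (success_branch d alg U))"

definition output_state :: "nat \<Rightarrow> nat \<Rightarrow> query_algorithm \<Rightarrow> complex mat \<Rightarrow> complex mat" where
  "output_state d a alg U =
     complex_of_real (1 / success_prob d alg U) \<cdot>\<^sub>m
       partial_trace (ref_dim alg * 2 ^ a) d (success_branch d alg U)"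

end

theory Submission
  imports Defs
begin

text \<open>
  Apply \<open>U\<close> to the second half of a maximally entangled state, with the ancillas in \<open>|0\<rangle>\<^sup>\<otimes>\<^sup>a\<close>.
  The component of the resulting state \<open>\<psi>\<close> with ancillas in \<open>|0\<rangle>\<^sup>\<otimes>\<^sup>a\<close> purifies a multiple of
  \<open>(\<rho> / \<alpha>)(\<rho> / \<alpha>)\<^sup>\<dagger> = \<Pi>\<^sub>r / (\<alpha> r)\<^sup>2\<close>, hence its reduced state is exactly \<open>\<rho>\<close> once normalised, and its norm
  is the known number \<open>s = 1 / (\<alpha> \<surd>(r d))\<close>, because \<open>tr \<Pi>\<^sub>r = r\<close>. With \<open>sin \<theta> = s\<close>, \<open>k\<close> rounds
  of amplitude amplification, each with two queries, raise the amplitude to \<open>sin ((2 k + 1) \<theta>)\<close>.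
  Choosing \<open>k\<close> such that \<open>\<pi>/4 \<le> (2 k + 1) \<theta> \<le> 3 \<pi>/4\<close> gives success probability at least
  \<open>1/2\<close> with \<open>2 k + 1 \<le> 3 / s\<close> queries, and there is no error at all.
\<close>

section \<open>Rank and trace of idempotent matrices\<close>

text \<open>A maximal independent set of columns has \<open>rank A\<close> members and spans the
  other columns; \<open>B\<close> lists these members and \<open>C\<close> holds the coordinates.
  That the columns of \<open>B\<close> are actual columns of \<open>A\<close> is recorded because an
  idempotent matrix fixes its own columns.\<close>

lemma (in vec_space) rank_factorization:
  assumes A: "A \<in> carrier_mat n nc"
  obtains B C where "B \<in> carrier_mat n (rank A)" "C \<in> carrier_mat (rank A) nc" "A = B * C"
    "set (cols B) \<subseteq> set (cols A)"
    "\<And>v. v \<in> carrier_vec (rank A) \<Longrightarrow> B *\<^sub>v v = 0\<^sub>v n \<Longrightarrow> v = 0\<^sub>v (rank A)"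
proof -
  let ?I = "\<lambda>T. T \<subseteq> set (cols A) \<and> lin_indpt T"
  have "\<exists>S. finite S \<and> maximal S ?I \<and> {} \<subseteq> S"
    by (rule maximal_exists_superset[of "set (cols A)"]) (auto simp: lin_dep_def)
  then obtain S where S: "finite S" "maximal S ?I"
    by blast
  have SA: "S \<subseteq> set (cols A)" and indpt: "lin_indpt S"
    using S(2) by (auto simp: maximal_def)
  have colsA: "set (cols A) \<subseteq> carrier_vec n"
    using A cols_dim by blast
  have SV: "S \<subseteq> carrier_vec n"
    using SA colsA by auto
  have card: "card S = rank A"
    using rank_card_indpt[OF A S(2)] by simp
  obtain bs where bs: "set bs = S" "distinct bs"
    using finite_distinct_list[OF S(1)] by blast
  have len: "length bs = rank A"
    using bs card distinct_card by fastforce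
  define B where "B = mat_of_cols n bs"
  have B: "B \<in> carrier_mat n (rank A)"
    by (simp add: B_def flip: len)
  have colsB: "cols B = bs"
    unfolding B_def using bs SV by (intro cols_mat_of_cols) auto
  \<comment> \<open>A column outside the span could be added to \<open>S\<close> without losing
    independence, against maximality.\<close>
  have "c \<in> span S" if c: "c \<in> set (cols A)" for c
  proof (rule ccontr)
    assume nc: "c \<notin> span S"
    then have "c \<notin> S"
      using span_mem[OF SV] by auto
    then have "lin_indpt (S \<union> {c})"
      using lin_dep_iff_in_span[OF SV indpt _ \<open>c \<notin> S\<close>] nc c colsA by blast
    then have "?I (S \<union> {c})"
      using SA c by simp
    then have "S \<union> {c} = S"
      using S(2) unfolding maximal_def by (metis Un_upper1)
    then show False
      using \<open>c \<notin> S\<close> by blast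
  qed
  then have "\<forall>j<nc. \<exists>v\<in>carrier_vec (rank A). B *\<^sub>v v = col A j"
  proof (intro allI impI)
    fix j assume j: "j < nc"
    assume "\<And>c. c \<in> set (cols A) \<Longrightarrow> c \<in> span S"
    moreover have "col A j \<in> set (cols A)"
      using A j by (metis carrier_matD(2) cols_length cols_nth nth_mem)
    ultimately obtain f where "col A j = lincomb f S"
      using finite_span[OF S(1) SV] by auto
    then have "B *\<^sub>v vec (rank A) (\<lambda>i. f (col B i)) = col A j"
      using mat_mult_eq_lincomb[OF B, of f] bs colsB by simp
    then show "\<exists>v\<in>carrier_vec (rank A). B *\<^sub>v v = col A j"
      by (metis vec_carrier)
  qed
  then obtain F where F: "\<And>j. j < nc \<Longrightarrow> F j \<in> carrier_vec (rank A) \<and> B *\<^sub>v F j = col A j"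
    by metis
  define C where "C = mat (rank A) nc (\<lambda>(i, j). F j $ i)"
  have C: "C \<in> carrier_mat (rank A) nc"
    by (simp add: C_def)
  have colC: "col C j = F j" if "j < nc" for j
    using F[OF that] that by (auto simp: C_def)
  have AB: "A = B * C"
  proof (rule mat_col_eqI)
    show "col A j = col (B * C) j" if "j < dim_col (B * C)" for j
      using that C colC[of j] F[of j] col_mult2[OF B C, of j] by simp
  qed (use A B C in auto)
  \<comment> \<open>The columns of \<open>B\<close> are distinct and independent, so a nonzero
    kernel vector would be a linear dependence among them.\<close>
  have inj: "v = 0\<^sub>v (rank A)" if "v \<in> carrier_vec (rank A)" "B *\<^sub>v v = 0\<^sub>v n" for v
    using lin_depI[OF B that(1) _ that(2)] indpt bs colsB by auto
  have "set (cols B) \<subseteq> set (cols A)"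
    using colsB bs SA by simp
  then show thesis
    by (rule that[OF B C AB _ inj])
qed

lemma tr_mult_commute:
  assumes "A \<in> carrier_mat n m" "B \<in> carrier_mat m n"
  shows "tr (A * B) = tr (B * A)"
proof -
  have "tr (A * B) = (\<Sum>i<n. \<Sum>j<m. A $$ (i, j) * B $$ (j, i))"
    using assms by (simp add: tr_def scalar_prod_def atLeast0LessThan)
  also have "\<dots> = (\<Sum>j<m. \<Sum>i<n. B $$ (j, i) * A $$ (i, j))"
    by (subst sum.swap) (simp add: mult.commute)
  also have "\<dots> = tr (B * A)"
    using assms by (simp add: tr_def scalar_prod_def atLeast0LessThan)
  finally show ?thesis .
qed

text \<open>
  In a rank factorization \<open>P = B C\<close> the columns of \<open>B\<close> are fixed by \<open>P\<close>, so \<open>B (C B) = B\<close> and,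
  \<open>B\<close> being injective, \<open>C B = 1\<close>.
\<close>

lemma tr_idempotent:
  assumes P: "P \<in> carrier_mat d d" and idem: "P * P = P"
  shows "tr P = of_nat (vec_space.rank d P)"
proof -
  interpret vec_space "TYPE(complex)" d .
  let ?r = "rank P"
  obtain B C where B: "B \<in> carrier_mat d ?r" and C: "C \<in> carrier_mat ?r d" and PBC: "P = B * C"
    and cols: "set (cols B) \<subseteq> set (cols P)"
    and inj: "\<And>v. v \<in> carrier_vec ?r \<Longrightarrow> B *\<^sub>v v = 0\<^sub>v d \<Longrightarrow> v = 0\<^sub>v ?r"
    using rank_factorization[OF P] by metis
  have PB: "P * B = B"
  proof (rule mat_col_eqI)
    fix k assume "k < dim_col B"
    then have k: "k < ?r" using B by simp
    then have "col B k \<in> set (cols B)"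
      using B by (metis carrier_matD(2) cols_length cols_nth nth_mem)
    then obtain j where j: "j < d" "col B k = col P j"
      using cols P by (metis carrier_matD(2) cols_length cols_nth in_set_conv_nth subsetD)
    then show "col (P * B) k = col B k"
      using col_mult2[OF P B k] col_mult2[OF P P j(1)] idem by simp
  qed (use P B in auto)
  have CB: "C * B \<in> carrier_mat ?r ?r"
    using B C by simp
  have "C * B = 1\<^sub>m ?r"
  proof (rule mat_col_eqI)
    fix k assume "k < dim_col (1\<^sub>m ?r :: complex mat)"
    then have k: "k < ?r" by simp
    have c: "col (C * B) k \<in> carrier_vec ?r" "col (1\<^sub>m ?r :: complex mat) k \<in> carrier_vec ?r"
      using CB k by (auto intro!: carrier_vecI)
    have "B *\<^sub>v col (C * B) k = col (B * (C * B)) k"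
      using col_mult2[OF B CB k] by simp
    also have "B * (C * B) = B * 1\<^sub>m ?r"
      using PB assoc_mult_mat[OF B C B] B by (simp add: PBC)
    also have "col (B * 1\<^sub>m ?r) k = B *\<^sub>v col (1\<^sub>m ?r) k"
      using col_mult2[OF B one_carrier_mat k] by simp
    finally have "B *\<^sub>v (col (C * B) k - col (1\<^sub>m ?r) k) = 0\<^sub>v d"
      using mult_minus_distrib_mat_vec[OF B c] B by auto
    then have "col (C * B) k - col (1\<^sub>m ?r) k = 0\<^sub>v ?r"
      using c by (intro inj) auto
    then have "(col (C * B) k - col (1\<^sub>m ?r) k) $ i = 0" if "i < ?r" for i
      using that by simp
    then show "col (C * B) k = col (1\<^sub>m ?r) k"
      using c CB k by (intro eq_vecI) auto
  qed (use B C in auto)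
  then have "tr (C * B) = of_nat ?r"
    by (simp add: tr_def)
  then show ?thesis
    using tr_mult_commute[OF B C] by (simp add: PBC)
qed

section \<open>Adjoints, Kronecker products and pure states\<close>

lemma dim_mat_adjoint [simp]:
  "dim_row (mat_adjoint A) = dim_col A" "dim_col (mat_adjoint A) = dim_row A"
  by (simp_all add: mat_adjoint_def)

lemma mat_adjoint_carrier [simp]: "A \<in> carrier_mat n m \<Longrightarrow> mat_adjoint A \<in> carrier_mat m n"
  by (intro carrier_matI) auto

lemma index_mat_adjoint [simp]:
  fixes A :: "complex mat"
  shows "i < dim_col A \<Longrightarrow> j < dim_row A \<Longrightarrow> mat_adjoint A $$ (i, j) = cnj (A $$ (j, i))"
  by (simp add: mat_adjoint_def mat_of_rows_index)

lemma mat_adjoint_adjoint [simp]: "mat_adjoint (mat_adjoint (A :: complex mat)) = A"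
  by (rule eq_matI) auto

lemma index_mult_mat_sum:
  assumes "A \<in> carrier_mat n m" "B \<in> carrier_mat m k" "i < n" "j < k"
  shows "(A * B) $$ (i, j) = (\<Sum>l<m. A $$ (i, l) * B $$ (l, j))"
  using assms by (simp add: scalar_prod_def atLeast0LessThan)

lemma mat_adjoint_mult:
  fixes A B :: "complex mat"
  assumes "A \<in> carrier_mat n m" "B \<in> carrier_mat m k"
  shows "mat_adjoint (A * B) = mat_adjoint B * mat_adjoint A"
  using assms by (intro eq_matI) (auto simp: scalar_prod_def mult.commute)

lemma mat_adjoint_one [simp]: "mat_adjoint (1\<^sub>m n :: complex mat) = 1\<^sub>m n"
  by (rule eq_matI) auto

text \<open>Blocks of length \<open>n\<close>: this turns a sum over a tensor-product index into a
  double sum over the indices of the two factors.\<close>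

lemma sum_nat_product: "(\<Sum>l<m * n. f l) = (\<Sum>i<m. \<Sum>j<n. f (i * n + j :: nat))"
proof -
  have "sum f {i * n..<i * n + n} = (\<Sum>j<n. f (i * n + j))" for i
    using sum.shift_bounds_nat_ivl[of f 0 "i * n" n] by (simp add: atLeast0LessThan add.commute)
  then show ?thesis
    using sum.nat_group[of f n m] by simp
qed

lemma nat_product_less:
  assumes "i < m" "j < (n :: nat)"
  shows "i * n + j < m * n"
proof -
  have "i * n + j < Suc i * n"
    using assms by simp
  also have "\<dots> \<le> m * n"
    using assms by (intro mult_le_mono1) simp
  finally show ?thesis .
qed

lemma dim_kron [simp]:
  "dim_row (kron A B) = dim_row A * dim_row B" "dim_col (kron A B) = dim_col A * dim_col B"
  by (simp_all add: kron_def)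

lemma kron_carrier [simp]:
  "A \<in> carrier_mat n m \<Longrightarrow> B \<in> carrier_mat n' m' \<Longrightarrow> kron A B \<in> carrier_mat (n * n') (m * m')"
  by (intro carrier_matI) auto

lemma index_kron:
  "i < dim_row A * dim_row B \<Longrightarrow> j < dim_col A * dim_col B \<Longrightarrow>
    kron A B $$ (i, j) = A $$ (i div dim_row B, j div dim_col B) * B $$ (i mod dim_row B, j mod dim_col B)"
  by (simp add: kron_def)

lemma div_mod_less:
  assumes "i < m * (n :: nat)"
  shows "i div n < m" "i mod n < n" "0 < n"
proof -
  show "0 < n" using assms by (cases n) auto
  then show "i div n < m" "i mod n < n"
    using assms less_mult_imp_div_less by auto
qed

text \<open>The summation index of the product on the right splits into a pair
  \<open>(p, q)\<close>, and each summand separates into a factor in \<open>p\<close> and a factor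
  in \<open>q\<close>.\<close>

lemma kron_mult:
  assumes "A \<in> carrier_mat n m" "B \<in> carrier_mat m k" "C \<in> carrier_mat n' m'" "D \<in> carrier_mat m' k'"
  shows "kron (A * B) (C * D) = kron A C * kron B D"
proof (rule eq_matI)
  fix i j assume "i < dim_row (kron A C * kron B D)" "j < dim_col (kron A C * kron B D)"
  then have i: "i < n * n'" and j: "j < k * k'"
    using assms by auto
  have "(kron A C * kron B D) $$ (i, j) = (\<Sum>l<m * m'. kron A C $$ (i, l) * kron B D $$ (l, j))"
    using assms i j by (intro index_mult_mat_sum kron_carrier) auto
  also have "\<dots> = (\<Sum>p<m. \<Sum>q<m'. A $$ (i div n', p) * C $$ (i mod n', q) * (B $$ (p, j div k') * D $$ (q, j mod k')))"
    unfolding sum_nat_product using assms i j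
    by (intro sum.cong refl) (auto simp: index_kron nat_product_less)
  also have "\<dots> = (\<Sum>p<m. A $$ (i div n', p) * B $$ (p, j div k')) * (\<Sum>q<m'. C $$ (i mod n', q) * D $$ (q, j mod k'))"
    unfolding sum_product by (simp add: mult_ac)
  also have "\<dots> = (A * B) $$ (i div n', j div k') * (C * D) $$ (i mod n', j mod k')"
    using assms div_mod_less[OF i] div_mod_less[OF j]
    by (simp add: index_mult_mat_sum[OF assms(1,2)] index_mult_mat_sum[OF assms(3,4)] del: index_mult_mat(1))
  also have "\<dots> = kron (A * B) (C * D) $$ (i, j)"
    using assms i j by (subst index_kron) auto
  finally show "kron (A * B) (C * D) $$ (i, j) = (kron A C * kron B D) $$ (i, j)" ..
qed (use assms in auto)

lemma kron_one_one [simp]: "kron (1\<^sub>m n) (1\<^sub>m m) = 1\<^sub>m (n * m)"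
proof (rule eq_matI)
  fix i j assume "i < dim_row (1\<^sub>m (n * m) :: complex mat)" "j < dim_col (1\<^sub>m (n * m) :: complex mat)"
  then have "i < n * m" "j < n * m" by auto
  then show "kron (1\<^sub>m n) (1\<^sub>m m) $$ (i, j) = 1\<^sub>m (n * m) $$ (i, j)"
    using div_mod_less[of i n m] div_mod_less[of j n m]
    by (auto simp: index_kron) (metis div_mult_mod_eq)
qed auto

lemma mat_adjoint_kron: "mat_adjoint (kron A B) = kron (mat_adjoint A) (mat_adjoint B)"
proof (rule eq_matI)
  fix i j
  assume "i < dim_row (kron (mat_adjoint A) (mat_adjoint B))" "j < dim_col (kron (mat_adjoint A) (mat_adjoint B))"
  then have "i < dim_col A * dim_col B" "j < dim_row A * dim_row B" by auto
  then show "mat_adjoint (kron A B) $$ (i, j) = kron (mat_adjoint A) (mat_adjoint B) $$ (i, j)"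
    using div_mod_less[of i "dim_col A" "dim_col B"] div_mod_less[of j "dim_row A" "dim_row B"]
    by (simp add: index_kron)
qed auto

lemma unitary_mat_kron_one:
  assumes "unitary_mat n U"
  shows "unitary_mat (m * n) (kron (1\<^sub>m m) U)"
proof -
  have U: "U \<in> carrier_mat n n" "mat_adjoint U \<in> carrier_mat n n"
    and "mat_adjoint U * U = 1\<^sub>m n" "U * mat_adjoint U = 1\<^sub>m n"
    using assms by (auto simp: unitary_mat_def)
  then show ?thesis
    using kron_mult[OF one_carrier_mat one_carrier_mat U(2,1), of m]
      kron_mult[OF one_carrier_mat one_carrier_mat U, of m]
    by (simp add: unitary_mat_def mat_adjoint_kron)
qed

section \<open>Reflections and pure states\<close>

text \<open>For a projector \<open>P\<close> this fixes the range of \<open>P\<close> and negates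
  its kernel. Amplification uses it for the projector onto the initial state and for
  \<open>1 - Q\<close>, where it equals \<open>1 - 2 Q\<close> and flips the sign of the good
  component.\<close>

definition reflection :: "nat \<Rightarrow> complex mat \<Rightarrow> complex mat" where
  "reflection n P = 2 \<cdot>\<^sub>m P - 1\<^sub>m n"

lemma reflection_mult:
  assumes P: "P \<in> carrier_mat n n" and x: "x \<in> carrier_mat n m"
  shows "reflection n P * x = 2 \<cdot>\<^sub>m (P * x) - x"
  using assms unfolding reflection_def
  by (subst minus_mult_distrib_mat[OF _ _ x]) (auto simp: mult_smult_assoc_mat[OF P x])

text \<open>With \<open>R = 2 P - 1\<close>, idempotence gives \<open>P R = P\<close>, hence
  \<open>R R = 2 P R - R = 2 P - R = 1\<close>; and \<open>R\<close> is Hermitian.\<close>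

lemma unitary_reflection:
  assumes P: "P \<in> carrier_mat n n" and herm: "mat_adjoint P = P" and idem: "P * P = P"
  shows "unitary_mat n (reflection n P)"
proof -
  have R: "reflection n P \<in> carrier_mat n n"
    using P by (simp add: reflection_def minus_carrier_mat)
  have "cnj (P $$ (j, i)) = P $$ (i, j)" if "i < n" "j < n" for i j
    using that P herm by (metis carrier_matD index_mat_adjoint)
  then have "mat_adjoint (reflection n P) = reflection n P"
    using P by (intro eq_matI) (auto simp: reflection_def)
  moreover have "P * reflection n P = P"
    using P unfolding reflection_def
    by (subst mult_minus_distrib_mat[OF P]) (auto simp: mult_smult_distrib[OF P P] idem intro!: eq_matI)
  then have "reflection n P * reflection n P = 1\<^sub>m n"
    using P by (subst reflection_mult[OF P R]) (auto simp: reflection_def intro!: eq_matI)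
  ultimately show ?thesis
    using R by (simp add: unitary_mat_def)
qed

text \<open>Reduces the evolution of a rank-one state to that of a vector. \<open>V\<close> is an
  arbitrary square matrix, so that the projection performed by the measurement is covered as
  well.\<close>

lemma unitary_channel_pure:
  assumes "V \<in> carrier_mat n n" "x \<in> carrier_mat n m"
  shows "unitary_channel V (x * mat_adjoint x) = (V * x) * mat_adjoint (V * x)"
proof -
  note V = assms(1) and x = assms(2) and V' = mat_adjoint_carrier[OF assms(1)] and x' = mat_adjoint_carrier[OF assms(2)]
  have "(V * x) * mat_adjoint (V * x) = V * x * (mat_adjoint x * mat_adjoint V)"
    by (simp add: mat_adjoint_mult[OF assms])
  also have "\<dots> = V * (x * (mat_adjoint x * mat_adjoint V))"
    by (rule assoc_mult_mat[OF V x mult_carrier_mat[OF x' V']])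
  also have "\<dots> = V * (x * mat_adjoint x) * mat_adjoint V"
    by (simp only: assoc_mult_mat[OF x x' V'] assoc_mult_mat[OF V mult_carrier_mat[OF x x'] V'])
  finally show ?thesis
    by (simp add: unitary_channel_def)
qed

text \<open>The quadratic form at \<open>v\<close> is the squared modulus of the inner product
  \<open>z\<close> of \<open>x\<close> and \<open>v\<close>, and the trace is the squared norm of
  \<open>x\<close>.\<close>

lemma density_operator_pure:
  assumes x: "x \<in> carrier_mat n 1" and norm: "mat_adjoint x * x = 1\<^sub>m 1"
  shows "density_operator n (x * mat_adjoint x)"
proof -
  have xx: "x * mat_adjoint x \<in> carrier_mat n n"
    using x by simp
  have ent: "(x * mat_adjoint x) $$ (i, j) = x $$ (i, 0) * cnj (x $$ (j, 0))" if "i < n" "j < n" for i j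
    using that x by (subst index_mult_mat_sum[of _ n 1 _ n]) auto
  have "mat_adjoint (x * mat_adjoint x) = x * mat_adjoint x"
    using mat_adjoint_mult[OF x mat_adjoint_carrier[OF x]] by simp
  moreover have "0 \<le> ((x * mat_adjoint x) *\<^sub>v v) \<bullet>c v" if v: "v \<in> carrier_vec n" for v
  proof -
    define z where "z = (\<Sum>j<n. cnj (x $$ (j, 0)) * v $ j)"
    have "((x * mat_adjoint x) *\<^sub>v v) \<bullet>c v = (\<Sum>i<n. ((x * mat_adjoint x) *\<^sub>v v) $ i * cnj (v $ i))"
      using v x by (simp add: scalar_prod_def atLeast0LessThan)
    also have "\<dots> = (\<Sum>i<n. (x $$ (i, 0) * z) * cnj (v $ i))"
    proof (intro sum.cong refl)
      fix i assume "i \<in> {..<n}"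
      then have i: "i < n" by simp
      have "((x * mat_adjoint x) *\<^sub>v v) $ i = (\<Sum>j<n. (x * mat_adjoint x) $$ (i, j) * v $ j)"
        using i v x xx unfolding mult_mat_vec_def scalar_prod_def
        by (auto simp: atLeast0LessThan simp del: index_mult_mat(1) intro!: sum.cong)
      also have "\<dots> = x $$ (i, 0) * z"
        using i by (simp add: z_def ent sum_distrib_left mult_ac)
      finally show "((x * mat_adjoint x) *\<^sub>v v) $ i * cnj (v $ i) = (x $$ (i, 0) * z) * cnj (v $ i)"
        by simp
    qed
    also have "\<dots> = z * cnj z"
      by (simp add: z_def sum_distrib_left mult_ac)
    also have "\<dots> \<ge> 0"
      by (simp add: less_eq_complex_def)
    finally show ?thesis .
  qed
  moreover have "tr (x * mat_adjoint x) = 1"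
    using tr_mult_commute[OF x mat_adjoint_carrier[OF x]] by (simp add: norm) (simp add: tr_def)
  ultimately show ?thesis
    using xx by (simp add: density_operator_def)
qed

section \<open>Amplitude amplification\<close>

text \<open>
  The coordinates \<open>(b, c)\<close> of the amplified state with respect to \<open>\<psi>\<close> and \<open>Q \<psi>\<close>, where
  \<open>\<parallel>Q \<psi>\<parallel> = s\<close>.
\<close>

primrec amplitudes :: "real \<Rightarrow> nat \<Rightarrow> real \<times> real" where
  "amplitudes s 0 = (1, 0)"
| "amplitudes s (Suc k) =
    (let (b, c) = amplitudes s k; t = b - (2 * b + c) * s\<^sup>2 in (2 * t - b, 2 * b + c))"

text \<open>Write \<psi> as a bad part of norm \<open>cos \<theta>\<close> plus the good part
  \<open>Q \<psi>\<close> of norm \<open>sin \<theta>\<close>. The vector with coordinates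
  \<open>(b, c)\<close> has bad amplitude \<open>b * cos \<theta>\<close> and good amplitude
  \<open>(b + c) * sin \<theta>\<close>, so these formulas place it at angle
  \<open>(2 k + 1) \<theta>\<close> from the bad axis: every round rotates by
  \<open>2 \<theta>\<close>.\<close>

lemma amplitudes_trig:
  assumes "sin \<theta> \<noteq> 0" "cos \<theta> \<noteq> 0"
  shows "fst (amplitudes (sin \<theta>) k) = cos ((2 * real k + 1) * \<theta>) / cos \<theta>"
    and "fst (amplitudes (sin \<theta>) k) + snd (amplitudes (sin \<theta>) k) = sin ((2 * real k + 1) * \<theta>) / sin \<theta>"
proof (induction k)
  case 0
  { case 1 show ?case using assms by simp next case 2 show ?case using assms by simp }
next
  case (Suc k)
  define \<phi> where "\<phi> = (2 * real k + 1) * \<theta>"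
  obtain b c where bc: "amplitudes (sin \<theta>) k = (b, c)"
    by (cases "amplitudes (sin \<theta>) k")
  have cos: "b * cos \<theta> = cos \<phi>" and sin: "(b + c) * sin \<theta> = sin \<phi>"
    using Suc assms by (simp_all add: bc \<phi>_def field_simps)
  have step: "(2 * real (Suc k) + 1) * \<theta> = \<phi> + 2 * \<theta>"
    by (simp add: \<phi>_def algebra_simps)
  define t where "t = b - (2 * b + c) * (sin \<theta>)\<^sup>2"
  have amp: "amplitudes (sin \<theta>) (Suc k) = (2 * t - b, 2 * b + c)"
    by (simp add: bc t_def Let_def)
  \<comment> \<open>The sign flip sends the angle \<phi> to -\<phi>, while \<psi> lies at angle
    \<theta>; \<open>t\<close> is the overlap of the two.\<close>
  have t: "t = cos (\<phi> + \<theta>)"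
  proof -
    have "t = b * cos \<theta> * cos \<theta> - (b + c) * sin \<theta> * sin \<theta>"
      unfolding t_def cos_squared_eq[of \<theta>, unfolded power2_eq_square] mult.assoc
      by (simp add: power2_eq_square algebra_simps)
    then show ?thesis
      by (simp add: cos sin cos_add)
  qed
  have s2: "sin \<theta> * sin \<theta> = 1 - cos \<theta> * cos \<theta>" and c2: "cos \<theta> * cos \<theta> = 1 - sin \<theta> * sin \<theta>"
    using sin_squared_eq[of \<theta>] by (simp_all add: power2_eq_square)
  { case 1
    have "(2 * t - b) * cos \<theta> = 2 * cos (\<phi> + \<theta>) * cos \<theta> - cos \<phi>"
      by (simp add: t cos left_diff_distrib)
    also have "\<dots> = cos (\<phi> + 2 * \<theta>)"
      unfolding cos_add cos_double sin_double power2_eq_square s2 by (simp add: algebra_simps)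
    finally show ?case
      unfolding amp step using assms by (simp add: field_simps)
  next
    case 2
    have "(2 * t + (b + c)) * sin \<theta> = 2 * cos (\<phi> + \<theta>) * sin \<theta> + sin \<phi>"
      unfolding distrib_right[of "2 * t" "b + c"] sin by (simp add: t)
    also have "\<dots> = sin (\<phi> + 2 * \<theta>)"
      unfolding cos_add sin_add cos_double sin_double power2_eq_square c2 by (simp add: algebra_simps)
    finally show ?case
      unfolding amp step using assms by (simp add: field_simps)
  }
qed

lemma sin_squared_ge_half:
  assumes "pi / 4 \<le> \<phi>" "\<phi> \<le> 3 * pi / 4"
  shows "1 / 2 \<le> (sin \<phi>)\<^sup>2"
proof -
  \<comment> \<open>The shifted angle lies between \<open>- pi / 2\<close> and
    \<open>pi / 2\<close>, and the shift by \<open>pi\<close> changes the sign of the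
    cosine.\<close>
  have "0 \<le> cos (2 * \<phi> - pi)"
    using assms by (intro cos_ge_zero) auto
  then have "cos (2 * \<phi>) \<le> 0"
    by (simp add: cos_diff)
  then show ?thesis
    using cos_double_sin[of \<phi>] by simp
qed

lemma amplification_rounds:
  assumes "0 < s" "s \<le> 1"
  shows "\<exists>k. 2 * real k + 1 \<le> 3 / s \<and>
    1 / 2 \<le> ((fst (amplitudes s k) + snd (amplitudes s k)) * s)\<^sup>2"
proof (cases "1 / 2 \<le> s\<^sup>2")
  case True
  then show ?thesis
    using assms by (intro exI[of _ 0]) (simp add: field_simps)
next
  case False
  define \<theta> where "\<theta> = arcsin s"
  have sin: "sin \<theta> = s"
    using assms by (simp add: \<theta>_def)
  have "0 < \<theta>" "\<theta> \<le> pi / 2"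
    using assms arcsin_less_arcsin[of 0 s] arcsin_bounded[of s] by (auto simp: \<theta>_def)
  have "\<theta> < pi / 4"
  proof (rule ccontr)
    assume "\<not> \<theta> < pi / 4"
    then have "1 / 2 \<le> (sin \<theta>)\<^sup>2"
      using \<open>\<theta> \<le> pi / 2\<close> by (intro sin_squared_ge_half) auto
    then show False
      using False by (simp add: sin)
  qed
  \<comment> \<open>The real solution of \<open>(2 * u + 1) * \<theta> = 3 * pi / 4\<close>;
    rounding down keeps the angle below the right end.\<close>
  define u where "u = (3 * pi / (4 * \<theta>) - 1) / 2"
  define k where "k = nat \<lfloor>u\<rfloor>"
  have "1 \<le> 3 * pi / (4 * \<theta>)"
    using \<open>0 < \<theta>\<close> \<open>\<theta> < pi / 4\<close> by (simp add: field_simps)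
  then have "0 \<le> u"
    by (simp add: u_def)
  then have k: "real k \<le> u" "u < real k + 1"
    by (simp_all add: k_def floor_correct)
  then have k1: "2 * real k + 1 \<le> 3 * pi / (4 * \<theta>)" "3 * pi / (4 * \<theta>) < 2 * real k + 3"
    by (simp_all add: u_def field_simps)
  then have "(2 * real k + 1) * \<theta> \<le> 3 * pi / 4" "pi / 4 \<le> (2 * real k + 1) * \<theta>"
    using \<open>0 < \<theta>\<close> \<open>\<theta> < pi / 4\<close> by (simp_all add: field_simps)
  then have "1 / 2 \<le> (sin ((2 * real k + 1) * \<theta>))\<^sup>2"
    by (intro sin_squared_ge_half)
  moreover have "cos \<theta> \<noteq> 0"
    using \<open>0 < \<theta>\<close> \<open>\<theta> < pi / 4\<close> cos_gt_zero_pi[of \<theta>] by simp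
  then have "(fst (amplitudes s k) + snd (amplitudes s k)) * s = sin ((2 * real k + 1) * \<theta>)"
    using amplitudes_trig(2)[of \<theta> k] assms by (simp add: sin)
  moreover have "3 * pi / (4 * \<theta>) \<le> 3 / s"
  proof -
    have "s \<le> \<theta>"
      using sin_x_le_x[of \<theta>] \<open>0 < \<theta>\<close> by (simp add: sin)
    then have "pi * s \<le> 4 * \<theta>"
      using pi_less_4 assms by (intro mult_mono) auto
    then show ?thesis
      using assms \<open>0 < \<theta>\<close> by (simp add: field_simps)
  qed
  ultimately show ?thesis
    using k1 by (intro exI[of _ k]) auto
qed

text \<open>The flip \<open>1 - 2 Q\<close> sends \<open>b \<psi> + c g\<close> to
  \<open>y = b \<psi> - (2 b + c) g\<close>. Conjugating the reflection about \<phi> by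
  \<open>W\<close> yields the reflection about \<psi>, which sends \<open>y\<close> to
  \<open>2 t \<psi> - y\<close>, where \<open>t\<close> is the inner product of \<psi> and
  \<open>y\<close>.\<close>

lemma amplification_step:
  fixes b c s :: real
  defines "t \<equiv> b - (2 * b + c) * s\<^sup>2"
  assumes W: "unitary_mat n W" and \<phi>: "\<phi> \<in> carrier_mat n 1"
    and Q: "Q \<in> carrier_mat n n" "Q * Q = Q"
    and \<psi>: "\<psi> = W * \<phi>" and g: "g = Q * \<psi>"
    and norm: "mat_adjoint \<psi> * \<psi> = 1\<^sub>m 1" "mat_adjoint \<psi> * g = complex_of_real (s\<^sup>2) \<cdot>\<^sub>m 1\<^sub>m 1"
  shows "W * (reflection n (\<phi> * mat_adjoint \<phi>) * (mat_adjoint W * (reflection n (1\<^sub>m n - Q) *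
      (complex_of_real b \<cdot>\<^sub>m \<psi> + complex_of_real c \<cdot>\<^sub>m g))))
    = complex_of_real (2 * t - b) \<cdot>\<^sub>m \<psi> + complex_of_real (2 * b + c) \<cdot>\<^sub>m g"
proof -
  have Wc: "W \<in> carrier_mat n n" and WW: "W * mat_adjoint W = 1\<^sub>m n"
    using W by (auto simp: unitary_mat_def)
  have \<psi>c: "\<psi> \<in> carrier_mat n 1" and gc: "g \<in> carrier_mat n 1"
    using Wc \<phi> Q by (auto simp: \<psi> g)
  note [simp] = Wc Q(1) \<phi> \<psi>c gc
  note [simp] = \<phi>[unfolded One_nat_def] \<psi>c[unfolded One_nat_def] gc[unfolded One_nat_def]
  define x where "x = complex_of_real b \<cdot>\<^sub>m \<psi> + complex_of_real c \<cdot>\<^sub>m g"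
  have xc: "x \<in> carrier_mat n 1"
    by (simp add: x_def)
  note [simp] = xc xc[unfolded One_nat_def]
  have Qg: "Q * g = g"
    using assoc_mult_mat[OF Q(1) Q(1) \<psi>c] by (simp add: g Q(2))
  have "Q * x = complex_of_real b \<cdot>\<^sub>m g + complex_of_real c \<cdot>\<^sub>m g"
    unfolding x_def
    by (subst mult_add_distrib_mat[of _ n n _ 1]) (auto simp: mult_smult_distrib[of _ n n _ 1] Qg g[symmetric])
  moreover have "(1\<^sub>m n - Q) * x = x - Q * x"
    by (subst minus_mult_distrib_mat[of _ n n _ _ 1]) (auto simp: left_mult_one_mat[OF xc])
  moreover have "reflection n (1\<^sub>m n - Q) * x = 2 \<cdot>\<^sub>m ((1\<^sub>m n - Q) * x) - x"
    by (rule reflection_mult[OF _ xc]) (simp add: minus_carrier_mat)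
  ultimately have "reflection n (1\<^sub>m n - Q) * x =
      complex_of_real b \<cdot>\<^sub>m \<psi> - complex_of_real (2 * b + c) \<cdot>\<^sub>m g" (is "_ = ?y")
    using \<psi>c gc by (auto simp: x_def algebra_simps intro!: eq_matI)
  define y where "y = ?y"
  have yc: "y \<in> carrier_mat n 1"
    by (simp add: y_def minus_carrier_mat)
  note [simp] = yc yc[unfolded One_nat_def]
  have "mat_adjoint \<psi> * y = complex_of_real t \<cdot>\<^sub>m 1\<^sub>m 1"
    unfolding y_def
    by (subst mult_minus_distrib_mat[of _ 1 n _ 1])
       (auto simp: mult_smult_distrib[of _ 1 n _ 1] norm t_def intro!: eq_matI)
  moreover have "mat_adjoint \<psi> = mat_adjoint \<phi> * mat_adjoint W"
    unfolding \<psi> by (rule mat_adjoint_mult[OF Wc \<phi>])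
  ultimately have "mat_adjoint \<phi> * (mat_adjoint W * y) = complex_of_real t \<cdot>\<^sub>m 1\<^sub>m 1"
    by (subst assoc_mult_mat[symmetric, of _ 1 n _ n _ 1]) auto
  then have "\<phi> * mat_adjoint \<phi> * (mat_adjoint W * y) = complex_of_real t \<cdot>\<^sub>m \<phi>"
    by (subst assoc_mult_mat[of _ n 1 _ n _ 1])
       (auto simp: mult_smult_distrib[of _ n 1 _ 1] mult_carrier_mat[of _ n n]
          right_mult_one_mat[OF \<phi>, unfolded One_nat_def])
  moreover have "reflection n (\<phi> * mat_adjoint \<phi>) * (mat_adjoint W * y)
      = 2 \<cdot>\<^sub>m (\<phi> * mat_adjoint \<phi> * (mat_adjoint W * y)) - mat_adjoint W * y"
    by (rule reflection_mult[where m = 1]) (auto simp: mult_carrier_mat[of _ n 1] mult_carrier_mat[of _ n n])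
  \<comment> \<open>\<open>W\<close> carries \<phi> to \<psi> and cancels
    \<open>mat_adjoint W\<close>.\<close>
  moreover have "W * (2 \<cdot>\<^sub>m (complex_of_real t \<cdot>\<^sub>m \<phi>) - mat_adjoint W * y)
      = 2 \<cdot>\<^sub>m (complex_of_real t \<cdot>\<^sub>m \<psi>) - y"
    using assoc_mult_mat[OF Wc mat_adjoint_carrier[OF Wc] yc] left_mult_one_mat[OF yc]
    by (subst mult_minus_distrib_mat[of _ n n _ 1])
       (auto simp: mult_smult_distrib[of _ n n _ 1] WW \<psi> mult_carrier_mat[of _ n n])
  ultimately have "W * (reflection n (\<phi> * mat_adjoint \<phi>) * (mat_adjoint W * y))
      = 2 \<cdot>\<^sub>m (complex_of_real t \<cdot>\<^sub>m \<psi>) - y"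
    by simp
  also have "\<dots> = complex_of_real (2 * t - b) \<cdot>\<^sub>m \<psi> + complex_of_real (2 * b + c) \<cdot>\<^sub>m g"
    using carrier_matD[OF \<psi>c] carrier_matD[OF gc] by (auto simp: y_def algebra_simps intro!: eq_matI)
  finally show ?thesis
    unfolding y_def x_def[symmetric] \<open>reflection n (1\<^sub>m n - Q) * x = ?y\<close> .
qed

section \<open>Execution of the amplification program\<close>

text \<open>The leading query prepares \<psi>; the last three instructions of a round compose to the
  reflection about \<psi>. Rounds are appended at the end because \<open>fold\<close> executes the
  list from the left.\<close>

primrec amplification_program :: "instruction \<Rightarrow> instruction \<Rightarrow> nat \<Rightarrow> instruction list" where
  "amplification_program S R 0 = [Query]"
| "amplification_program S R (Suc k) = amplification_program S R k @ [S, Query_Adjoint, R, Query]"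

lemma num_queries_amplification:
  "num_queries \<lparr>ref_dim = w, init_state = \<sigma>,
      program = amplification_program (Fixed_Unitary V) (Fixed_Unitary V') k,
      meas_success = M, meas_failure = M'\<rparr> = 2 * k + 1"
  unfolding num_queries_def by (induction k) auto

lemma set_amplification_program:
  "Fixed_Unitary V \<in> set (amplification_program S R k) \<Longrightarrow> Fixed_Unitary V \<in> {S, R}"
  by (induction k) auto

text \<open>Each instruction maps \<open>x * mat_adjoint x\<close> to the same expression for the
  transformed vector, so the induction step is one application of
  \<open>amplification_step\<close>.\<close>

lemma amplification_program_state:
  fixes s :: real
  assumes U: "unitary_mat m U" and n: "n = w * m" and \<phi>: "\<phi> \<in> carrier_mat n 1"
    and Q: "Q \<in> carrier_mat n n" "Q * Q = Q"
    and \<psi>: "\<psi> = kron (1\<^sub>m w) U * \<phi>" and g: "g = Q * \<psi>"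
    and norm: "mat_adjoint \<psi> * \<psi> = 1\<^sub>m 1" "mat_adjoint \<psi> * g = complex_of_real (s\<^sup>2) \<cdot>\<^sub>m 1\<^sub>m 1"
    and x: "x = complex_of_real (fst (amplitudes s k)) \<cdot>\<^sub>m \<psi> + complex_of_real (snd (amplitudes s k)) \<cdot>\<^sub>m g"
  shows "fold (exec_instruction w U)
     (amplification_program (Fixed_Unitary (reflection n (1\<^sub>m n - Q)))
        (Fixed_Unitary (reflection n (\<phi> * mat_adjoint \<phi>))) k)
     (\<phi> * mat_adjoint \<phi>) = x * mat_adjoint x"
  unfolding x
proof (induction k)
  let ?W = "kron (1\<^sub>m w) U"
  have W: "unitary_mat n ?W"
    using unitary_mat_kron_one[OF U] n by simp
  have Uc: "U \<in> carrier_mat m m"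
    using U by (simp add: unitary_mat_def)
  have Wc: "?W \<in> carrier_mat n n"
    using W by (simp add: unitary_mat_def)
  have \<psi>c: "\<psi> \<in> carrier_mat n 1" and gc: "g \<in> carrier_mat n 1"
    using Wc \<phi> Q by (auto simp: \<psi> g)
  {
    case 0
    have "complex_of_real 1 \<cdot>\<^sub>m \<psi> + complex_of_real 0 \<cdot>\<^sub>m g = \<psi>"
      using \<psi>c gc by (intro eq_matI) auto
    then show ?case
      using unitary_channel_pure[OF Wc \<phi>] by (simp add: \<psi>)
  next
    case (Suc k)
    obtain b c where bc: "amplitudes s k = (b, c)"
      by (cases "amplitudes s k")
    define x where "x = complex_of_real b \<cdot>\<^sub>m \<psi> + complex_of_real c \<cdot>\<^sub>m g"
    have xc: "x \<in> carrier_mat n 1"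
      using \<psi>c gc by (simp add: x_def)
    let ?R = "reflection n (\<phi> * mat_adjoint \<phi>)" and ?S = "reflection n (1\<^sub>m n - Q)"
    have R: "?R \<in> carrier_mat n n" and S: "?S \<in> carrier_mat n n"
      by (auto simp: reflection_def minus_carrier_mat)
    have adj: "kron (1\<^sub>m w) (mat_adjoint U) = mat_adjoint ?W"
      by (simp add: mat_adjoint_kron)
    have W': "mat_adjoint ?W \<in> carrier_mat n n"
      using Wc by (rule mat_adjoint_carrier)
    note car = mult_carrier_mat[OF S xc] mult_carrier_mat[OF W' mult_carrier_mat[OF S xc]]
    note car = car mult_carrier_mat[OF R car(2)]
    show ?case
      using amplification_step[OF W \<phi> Q \<psi> g norm, of b c] Suc
      by (simp add: bc adj x_def[symmetric] Let_def unitary_channel_pure[OF S xc]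
          unitary_channel_pure[OF W' car(1)] unitary_channel_pure[OF R car(2)]
          unitary_channel_pure[OF Wc car(3)])
  }
qed

section \<open>Vanishing trace distance\<close>

lemma trace_norm_zero [simp]: "trace_norm (0\<^sub>m d d) = 0"
proof -
  have Z: "(0\<^sub>m d d :: complex mat) \<in> carrier_mat d d"
    by simp
  have "mat_adjoint (0\<^sub>m d d) * (0\<^sub>m d d :: complex mat) = 0\<^sub>m d d"
    by (intro right_mult_zero_mat) auto
  moreover have "sqrt (Re x) = 0" if "x \<in># proots (char_poly (0\<^sub>m d d :: complex mat))" for x
  proof -
    \<comment> \<open>Membership in \<open>proots\<close> means being a root only for a nonzero
      polynomial.\<close>
    have "char_poly (0\<^sub>m d d :: complex mat) \<noteq> 0"
      using degree_monic_char_poly[OF Z] by auto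
    then have "eigenvalue (0\<^sub>m d d) x"
      using that eigenvalue_root_char_poly[OF Z] by simp
    then obtain v where "v \<in> carrier_vec d" "v \<noteq> 0\<^sub>v d" "0\<^sub>m d d *\<^sub>v v = x \<cdot>\<^sub>v v"
      by (auto simp: eigenvalue_def eigenvector_def)
    then have "\<forall>i<d. x * v $ i = 0" "\<exists>i<d. v $ i \<noteq> 0"
      by (auto simp: vec_eq_iff)
    then show ?thesis
      by auto
  qed
  ultimately show ?thesis
    unfolding trace_norm_def by (intro sum_mset.neutral) auto
qed

section \<open>The starting state and the block encoding\<close>

text \<open>Serves both the sign flip, built from \<open>1 - Q\<close>, and the failure operator
  \<open>1 - M\<close>.\<close>

lemma complement_projector:
  fixes P :: "complex mat"
  assumes P: "P \<in> carrier_mat n n" and herm: "mat_adjoint P = P" and idem: "P * P = P"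
  shows "1\<^sub>m n - P \<in> carrier_mat n n" "mat_adjoint (1\<^sub>m n - P) = 1\<^sub>m n - P"
    "(1\<^sub>m n - P) * (1\<^sub>m n - P) = 1\<^sub>m n - P"
proof -
  show car: "1\<^sub>m n - P \<in> carrier_mat n n"
    using P by (simp add: minus_carrier_mat)
  have "cnj (P $$ (j, i)) = P $$ (i, j)" if "i < n" "j < n" for i j
    using that P herm by (metis carrier_matD index_mat_adjoint)
  then show "mat_adjoint (1\<^sub>m n - P) = 1\<^sub>m n - P"
    using P by (intro eq_matI) auto
  have "P * (1\<^sub>m n - P) = 0\<^sub>m n n"
    using P by (subst mult_minus_distrib_mat[of _ n n _ n]) (auto simp: idem)
  then show "(1\<^sub>m n - P) * (1\<^sub>m n - P) = 1\<^sub>m n - P"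
    using P car left_mult_one_mat[OF car]
    by (subst minus_mult_distrib_mat[of _ n n _ _ n]) (auto intro!: eq_matI)
qed

lemma ket_zero_eq: "ket_zero a = mat (2 ^ a) 1 (\<lambda>(i, j). if i = 0 then 1 else 0)"
proof (induction a)
  case 0
  show ?case
    by (auto intro!: eq_matI)
next
  case (Suc a)
  show ?case
  proof (rule eq_matI)
    fix i j
    assume "i < dim_row (mat (2 ^ Suc a) 1 (\<lambda>(i, j). if i = 0 then 1 else 0 :: complex))"
      "j < dim_col (mat (2 ^ Suc a) 1 (\<lambda>(i, j). if i = 0 then 1 else 0 :: complex))"
    then have i: "i < 2 * 2 ^ a" and j: "j = 0"
      by auto
    have "i = 0 \<longleftrightarrow> i div 2 ^ a = 0 \<and> i mod 2 ^ a = 0"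
      by (metis add_0 div_0 div_mult_mod_eq mod_0 mult_0)
    then show "ket_zero (Suc a) $$ (i, j) = mat (2 ^ Suc a) 1 (\<lambda>(i, j). if i = 0 then 1 else 0) $$ (i, j)"
      using i j div_mod_less[OF i]
      by (auto simp: Suc index_kron mat_of_cols_index unit_vec_def)
  qed (auto simp: Suc)
qed

text \<open>The ancillas are the more significant part of the index, so adjoining ancillas in the
  zero state is the inclusion of the first \<open>d\<close> coordinates.\<close>

lemma kron_ket_zero_one:
  assumes "l < 2 ^ a * d" "j < d"
  shows "kron (ket_zero a) (1\<^sub>m d) $$ (l, j) = (if l = j then 1 else 0)"
proof -
  have "l = j \<longleftrightarrow> l div d = 0 \<and> l mod d = j"
    using assms by (metis div_less div_mult_mod_eq mod_less mult_0 add_0)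
  then show ?thesis
    using assms div_mod_less[OF assms(1)] by (auto simp: index_kron ket_zero_eq)
qed

text \<open>Compressing by that inclusion on both sides picks out the upper left \<open>d\<close> by
  \<open>d\<close> block of \<open>U\<close>.\<close>

lemma block_encoding_index:
  assumes "block_encoding d \<alpha> a A U" "i < d" "j < d"
  shows "A $$ (i, j) = complex_of_real \<alpha> * U $$ (i, j)"
proof -
  let ?n = "2 ^ a * d"
  let ?K = "kron (ket_zero a) (1\<^sub>m d)"
  have U: "U \<in> carrier_mat ?n ?n"
    and A: "A = complex_of_real \<alpha> \<cdot>\<^sub>m (kron (mat_adjoint (ket_zero a)) (1\<^sub>m d) * U * ?K)"
    using assms(1) by (auto simp: block_encoding_def unitary_mat_def)
  have K: "?K \<in> carrier_mat ?n d"
    by (intro carrier_matI) (auto simp: ket_zero_eq)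
  have adj: "kron (mat_adjoint (ket_zero a)) (1\<^sub>m d) = mat_adjoint ?K"
    by (simp add: mat_adjoint_kron)
  have "d \<le> ?n"
    by simp
  then have ij: "i < ?n" "j < ?n"
    using assms(2,3) by linarith+
  have Kadj: "mat_adjoint ?K $$ (i, l) = (if l = i then 1 else 0)" if "l < ?n" for l
    using kron_ket_zero_one[OF that assms(2)] that carrier_matD[OF K] assms(2) by (simp del: dim_kron)
  have "(mat_adjoint ?K * U) $$ (i, l) = U $$ (i, l)" if l: "l < ?n" for l
  proof -
    have "(mat_adjoint ?K * U) $$ (i, l) = (\<Sum>q<?n. mat_adjoint ?K $$ (i, q) * U $$ (q, l))"
      by (rule index_mult_mat_sum[OF mat_adjoint_carrier[OF K] U assms(2) l])
    also have "\<dots> = (\<Sum>q<?n. if q = i then U $$ (q, l) else 0)"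
      by (intro sum.cong) (auto simp: Kadj)
    finally show ?thesis
      using ij by simp
  qed
  note KU = this
  have KUc: "mat_adjoint ?K * U \<in> carrier_mat d ?n"
    using mat_adjoint_carrier[OF K] U by (rule mult_carrier_mat)
  have "(mat_adjoint ?K * U * ?K) $$ (i, j) = (\<Sum>l<?n. (mat_adjoint ?K * U) $$ (i, l) * ?K $$ (l, j))"
    by (rule index_mult_mat_sum[OF KUc K assms(2,3)])
  also have "\<dots> = (\<Sum>l<?n. if l = j then U $$ (i, l) else 0)"
    using assms(3) by (intro sum.cong) (auto simp: KU kron_ket_zero_one simp del: index_mult_mat(1))
  also have "\<dots> = U $$ (i, j)"
    using ij by simp
  finally have "(mat_adjoint ?K * U * ?K) $$ (i, j) = U $$ (i, j)" .
  moreover have "(c \<cdot>\<^sub>m X) $$ (i, j) = c * X $$ (i, j)" if "X \<in> carrier_mat d d" for c and X :: "complex mat"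
    using that assms(2,3) by auto
  ultimately show ?thesis
    unfolding A adj using mult_carrier_mat[OF KUc K] by metis
qed

text \<open>The projector onto \<open>|0\<rangle>\<^sup>\<otimes>\<^sup>a\<close> in the last factor of \<open>\<complex>\<^sup>w \<otimes> (\<complex>\<^sup>2)\<^sup>\<otimes>\<^sup>a\<close>.\<close>

definition ancilla_zero :: "nat \<Rightarrow> nat \<Rightarrow> complex mat" where
  "ancilla_zero w a = mat (w * 2 ^ a) (w * 2 ^ a) (\<lambda>(i, j). if i = j \<and> i mod 2 ^ a = 0 then 1 else 0)"

lemma ancilla_zero_projector:
  "ancilla_zero w a \<in> carrier_mat (w * 2 ^ a) (w * 2 ^ a)"
  "mat_adjoint (ancilla_zero w a) = ancilla_zero w a"
  "ancilla_zero w a * ancilla_zero w a = ancilla_zero w a"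
proof -
  let ?M = "ancilla_zero w a" and ?n = "w * 2 ^ a"
  show M: "?M \<in> carrier_mat ?n ?n"
    by (simp add: ancilla_zero_def)
  show "mat_adjoint ?M = ?M"
    by (intro eq_matI) (auto simp: ancilla_zero_def)
  show "?M * ?M = ?M"
  proof (rule eq_matI)
    fix i j assume "i < dim_row ?M" "j < dim_col ?M"
    then have i: "i < ?n" and j: "j < ?n"
      using M by auto
    have "(?M * ?M) $$ (i, j) = (\<Sum>l<?n. ?M $$ (i, l) * ?M $$ (l, j))"
      by (rule index_mult_mat_sum[OF M M i j])
    also have "\<dots> = (\<Sum>l<?n. if l = i then ?M $$ (i, j) else 0)"
      using i j by (intro sum.cong) (auto simp: ancilla_zero_def)
    finally show "(?M * ?M) $$ (i, j) = ?M $$ (i, j)"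
      using i by simp
  qed (use M in auto)
qed

lemma kron_ancilla_zero_mult:
  assumes x: "x \<in> carrier_mat (w * 2 ^ a * d) 1" and l: "l < w * 2 ^ a * d"
  shows "(kron (ancilla_zero w a) (1\<^sub>m d) * x) $$ (l, 0) = (if l mod (2 ^ a * d) < d then x $$ (l, 0) else 0)"
proof -
  let ?M = "ancilla_zero w a" and ?n = "w * 2 ^ a * d"
  have K: "kron ?M (1\<^sub>m d) \<in> carrier_mat ?n ?n"
    using ancilla_zero_projector(1) by (intro kron_carrier) auto
  have "0 < d"
    using l by (cases d) auto
  \<comment> \<open>Within the query register the index is \<open>d\<close> times the ancilla index
    plus the system index, hence below \<open>d\<close> exactly when the ancilla index is 0.\<close>
  have good: "(l div d) mod 2 ^ a = 0 \<longleftrightarrow> l mod (2 ^ a * d) < d"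
  proof -
    have "l mod (2 ^ a * d) = d * (l div d mod 2 ^ a) + l mod d"
      by (simp add: mod_mult2_eq[symmetric] mult.commute)
    then show ?thesis
      using \<open>0 < d\<close> by (cases "l div d mod 2 ^ a") auto
  qed
  have "(kron ?M (1\<^sub>m d) * x) $$ (l, 0) = (\<Sum>q<?n. kron ?M (1\<^sub>m d) $$ (l, q) * x $$ (q, 0))"
    by (rule index_mult_mat_sum[OF K x l]) simp
  also have "\<dots> = (\<Sum>q<?n. if q = l then (if l mod (2 ^ a * d) < d then x $$ (l, 0) else 0) else 0)"
  proof (intro sum.cong refl)
    fix q assume "q \<in> {..<?n}"
    then have q: "q < ?n"
      by simp
    have "l = q \<longleftrightarrow> l div d = q div d \<and> l mod d = q mod d"
      by (metis div_mult_mod_eq)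
    then show "kron ?M (1\<^sub>m d) $$ (l, q) * x $$ (q, 0) =
        (if q = l then (if l mod (2 ^ a * d) < d then x $$ (l, 0) else 0) else 0)"
      using l q div_mod_less[OF l] div_mod_less[OF q] good
      by (auto simp: index_kron ancilla_zero_def)
  qed
  finally show ?thesis
    using l by simp
qed

text \<open>
  The state \<open>d\<^sup>-\<^sup>1\<^sup>/\<^sup>2 \<Sum>\<^sub>i |i\<rangle> \<otimes> |0\<rangle>\<^sup>\<otimes>\<^sup>a \<otimes> |i\<rangle>\<close> of \<open>\<complex>\<^sup>d \<otimes> \<complex>\<^sup>n\<close>, \<open>n = 2\<^sup>a d\<close>: the index of \<open>|0\<rangle>\<^sup>\<otimes>\<^sup>a \<otimes> |i\<rangle>\<close> is \<open>i\<close>.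
\<close>

definition entangled_state :: "nat \<Rightarrow> nat \<Rightarrow> complex mat" where
  "entangled_state d n = mat (d * n) 1
     (\<lambda>(l, j). if l mod n = l div n then complex_of_real (1 / sqrt (real d)) else 0)"

text \<open>The state lists the first \<open>d\<close> columns of \<open>U\<close>, scaled by
  \<open>1 / sqrt d\<close>: the reference index \<open>l div n\<close> selects the column and
  \<open>l mod n\<close> the row.\<close>

lemma kron_entangled_state:
  assumes U: "U \<in> carrier_mat n n" and "d \<le> n" and l: "l < d * n"
  shows "(kron (1\<^sub>m d) U * entangled_state d n) $$ (l, 0) =
    complex_of_real (1 / sqrt (real d)) * U $$ (l mod n, l div n)"
proof -
  let ?c = "complex_of_real (1 / sqrt (real d))"
  note dm = div_mod_less[OF l]
  have W: "kron (1\<^sub>m d) U \<in> carrier_mat (d * n) (d * n)"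
    using U by (intro kron_carrier) auto
  have \<phi>: "entangled_state d n \<in> carrier_mat (d * n) 1"
    by (simp add: entangled_state_def)
  have "(kron (1\<^sub>m d) U * entangled_state d n) $$ (l, 0) =
      (\<Sum>q<d * n. kron (1\<^sub>m d) U $$ (l, q) * entangled_state d n $$ (q, 0))"
    by (rule index_mult_mat_sum[OF W \<phi> l]) simp
  also have "\<dots> = (\<Sum>i<d. \<Sum>m<n. if i = l div n then (if m = i then ?c * U $$ (l mod n, m) else 0) else 0)"
    unfolding sum_nat_product using U l dm
    by (intro sum.cong refl) (auto simp: index_kron nat_product_less entangled_state_def)
  also have "\<dots> = (\<Sum>i<d. if i = l div n then ?c * U $$ (l mod n, i) else 0)"
    using \<open>d \<le> n\<close> by (intro sum.cong refl) auto
  finally show ?thesis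
    using dm by simp
qed

lemma adjoint_mult_self:
  fixes x :: "complex mat"
  assumes "x \<in> carrier_mat n 1"
  shows "mat_adjoint x * x = complex_of_real (\<Sum>l<n. (cmod (x $$ (l, 0)))\<^sup>2) \<cdot>\<^sub>m 1\<^sub>m 1"
proof (rule eq_matI)
  fix i j assume "i < dim_row (complex_of_real (\<Sum>l<n. (cmod (x $$ (l, 0)))\<^sup>2) \<cdot>\<^sub>m (1\<^sub>m 1 :: complex mat))"
    "j < dim_col (complex_of_real (\<Sum>l<n. (cmod (x $$ (l, 0)))\<^sup>2) \<cdot>\<^sub>m (1\<^sub>m 1 :: complex mat))"
  then have ij: "i = 0" "j = 0" by auto
  have "(mat_adjoint x * x) $$ (0, 0) = (\<Sum>l<n. mat_adjoint x $$ (0, l) * x $$ (l, 0))"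
    using assms by (intro index_mult_mat_sum) auto
  also have "\<dots> = (\<Sum>l<n. complex_of_real ((cmod (x $$ (l, 0)))\<^sup>2))"
    using assms by (intro sum.cong refl) (auto simp: complex_norm_square mult.commute simp del: of_real_power)
  finally show "(mat_adjoint x * x) $$ (i, j) =
      (complex_of_real (\<Sum>l<n. (cmod (x $$ (l, 0)))\<^sup>2) \<cdot>\<^sub>m 1\<^sub>m 1) $$ (i, j)"
    by (simp add: ij)
qed (use assms in auto)

lemma entangled_state_carrier: "entangled_state d n \<in> carrier_mat (d * n) 1"
  by (simp add: entangled_state_def)

lemma entangled_state_norm:
  assumes "0 < d" "d \<le> n"
  shows "mat_adjoint (entangled_state d n) * entangled_state d n = 1\<^sub>m 1"
proof -
  have "(\<Sum>l<d * n. (cmod (entangled_state d n $$ (l, 0)))\<^sup>2) = (\<Sum>i<d. \<Sum>m<n. if m = i then 1 / real d else 0)"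
    unfolding sum_nat_product
    by (intro sum.cong refl) (auto simp: entangled_state_def nat_product_less norm_divide power_divide)
  \<comment> \<open>Since \<open>i < d \<le> n\<close>, each block has exactly one nonzero
    entry.\<close>
  also have "\<dots> = (\<Sum>i<d. 1 / real d)"
    using assms by (intro sum.cong refl) auto
  finally show ?thesis
    using assms unfolding adjoint_mult_self[OF entangled_state_carrier] by auto
qed

section \<open>The output of the algorithm\<close>

lemma tr_partial_trace:
  assumes "A \<in> carrier_mat (n * m) (n * m)"
  shows "tr (partial_trace n m A) = tr A"
proof -
  have "tr (partial_trace n m A) = (\<Sum>i<m. \<Sum>k<n. A $$ (k * m + i, k * m + i))"
    by (simp add: tr_def partial_trace_def)
  also have "\<dots> = tr A"
    using assms by (subst sum.swap) (simp add: tr_def sum_nat_product)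
  finally show ?thesis .
qed

lemma tr_smult: "A \<in> carrier_mat n n \<Longrightarrow> tr (c \<cdot>\<^sub>m A) = c * tr A"
  by (simp add: tr_def sum_distrib_left)

lemma smult_smult_assoc_mat: "a \<cdot>\<^sub>m (b \<cdot>\<^sub>m A) = (a * b) \<cdot>\<^sub>m (A :: complex mat)"
  by (intro eq_matI) (auto simp: mult_ac)

lemma partial_trace_smult:
  assumes "A \<in> carrier_mat (n * m) (n * m)"
  shows "partial_trace n m (c \<cdot>\<^sub>m A) = c \<cdot>\<^sub>m partial_trace n m A"
  using assms by (intro eq_matI) (auto simp: partial_trace_def sum_distrib_left nat_product_less)

text \<open>The projection leaves amplitude \<open>A $$ (l, p) / sqrt d\<close> at reference
  \<open>p\<close>, ancilla 0 and system \<open>l\<close>. Summing over \<open>p\<close> in the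
  partial trace produces the matrix product of \<open>A\<close> with its adjoint.\<close>

lemma partial_trace_block_encoded:
  fixes d a :: nat
  defines "n \<equiv> 2 ^ a * d"
  assumes "0 < d" and U: "U \<in> carrier_mat n n"
    and g: "g = kron (ancilla_zero d a) (1\<^sub>m d) * (kron (1\<^sub>m d) U * entangled_state d n)"
    and A: "A \<in> carrier_mat d d" and UA: "\<And>i j. i < d \<Longrightarrow> j < d \<Longrightarrow> U $$ (i, j) = A $$ (i, j)"
  shows "partial_trace (d * 2 ^ a) d (g * mat_adjoint g) = complex_of_real (1 / real d) \<cdot>\<^sub>m (A * mat_adjoint A)"
proof (rule eq_matI)
  fix i j
  assume "i < dim_row (complex_of_real (1 / real d) \<cdot>\<^sub>m (A * mat_adjoint A))"
    "j < dim_col (complex_of_real (1 / real d) \<cdot>\<^sub>m (A * mat_adjoint A))"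
  then have i: "i < d" and j: "j < d"
    using A by auto
  let ?c = "complex_of_real (1 / sqrt (real d))"
  have cc: "?c * ?c = complex_of_real (1 / real d)"
    by (simp flip: of_real_mult)
  have alg: "(?c * x) * cnj (?c * y) = complex_of_real (1 / real d) * (x * cnj y)" for x y
    unfolding cc[symmetric] complex_cnj_mult complex_cnj_complex_of_real by (simp only: mult_ac)
  have N: "d * 2 ^ a * d = d * n"
    by (simp add: n_def mult.assoc)
  have "d \<le> n"
    by (simp add: n_def)
  have \<psi>: "kron (1\<^sub>m d) U * entangled_state d n \<in> carrier_mat (d * 2 ^ a * d) 1"
    unfolding N using U entangled_state_carrier
    by (intro mult_carrier_mat[of _ _ "d * n"] kron_carrier) auto
  have gc: "g \<in> carrier_mat (d * 2 ^ a * d) 1"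
    unfolding g using ancilla_zero_projector(1)
    by (intro mult_carrier_mat[OF _ \<psi>] kron_carrier) auto
  have g_entry: "g $$ (l, 0) = (if l mod n < d then ?c * U $$ (l mod n, l div n) else 0)" if l: "l < d * n" for l
    unfolding g using l kron_ancilla_zero_mult[OF \<psi>] kron_entangled_state[OF U \<open>d \<le> n\<close> l]
    by (simp add: N n_def[symmetric] del: index_mult_mat(1))
  have gg: "(g * mat_adjoint g) $$ (l, m) = g $$ (l, 0) * cnj (g $$ (m, 0))"
    if "l < d * n" "m < d * n" for l m
    using that gc by (subst index_mult_mat_sum[OF gc mat_adjoint_carrier[OF gc]]) (auto simp: N)
  \<comment> \<open>The traced-out index is \<open>p * 2 ^ a + q\<close>, with \<open>p\<close> the
    reference index and \<open>q\<close> the ancilla index.\<close>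
  have g_pos: "(p * 2 ^ a + q) * d + l < d * n"
    "g $$ ((p * 2 ^ a + q) * d + l, 0) = (if q = 0 then ?c * A $$ (l, p) else 0)"
    if "p < d" "q < 2 ^ a" "l < d" for p q l
  proof -
    have eq: "(p * 2 ^ a + q) * d + l = p * n + (q * d + l)"
      by (simp add: n_def algebra_simps)
    have "q * d + l < n"
      unfolding n_def using that by (intro nat_product_less)
    then show less: "(p * 2 ^ a + q) * d + l < d * n"
      unfolding eq using that by (intro nat_product_less)
    have md: "((p * 2 ^ a + q) * d + l) mod n = q * d + l" "((p * 2 ^ a + q) * d + l) div n = p"
      unfolding eq using \<open>q * d + l < n\<close> by auto
    have iff: "q * d + l < d \<longleftrightarrow> q = 0"
      using that by (cases q) auto
    show "g $$ ((p * 2 ^ a + q) * d + l, 0) = (if q = 0 then ?c * A $$ (l, p) else 0)"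
      unfolding g_entry[OF less] md iff using that UA by simp
  qed
  have "partial_trace (d * 2 ^ a) d (g * mat_adjoint g) $$ (i, j) =
      (\<Sum>k<d * 2 ^ a. (g * mat_adjoint g) $$ (k * d + i, k * d + j))"
    using i j by (simp add: partial_trace_def)
  also have "\<dots> = (\<Sum>p<d. \<Sum>q<(2 :: nat) ^ a.
      if q = 0 then complex_of_real (1 / real d) * (A $$ (i, p) * cnj (A $$ (j, p))) else 0)"
    unfolding sum_nat_product
  proof (intro sum.cong refl)
    fix p q :: nat assume "p \<in> {..<d}" "q \<in> {..<2 ^ a}"
    then have pq: "p < d" "q < 2 ^ a" by auto
    show "(g * mat_adjoint g) $$ ((p * 2 ^ a + q) * d + i, (p * 2 ^ a + q) * d + j) =
        (if q = 0 then complex_of_real (1 / real d) * (A $$ (i, p) * cnj (A $$ (j, p))) else 0)"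
      unfolding gg[OF g_pos(1)[OF pq i] g_pos(1)[OF pq j]] g_pos(2)[OF pq i] g_pos(2)[OF pq j]
      by (cases "q = 0") (simp_all only: alg if_True if_False mult_zero_left simp_thms)
  qed
  also have "\<dots> = complex_of_real (1 / real d) * (\<Sum>p<d. A $$ (i, p) * cnj (A $$ (j, p)))"
    by (simp add: sum_distrib_left)
  also have "(\<Sum>p<d. A $$ (i, p) * cnj (A $$ (j, p))) = (A * mat_adjoint A) $$ (i, j)"
    using A i j by (subst index_mult_mat_sum[OF A mat_adjoint_carrier[OF A] i j]) auto
  finally show "partial_trace (d * 2 ^ a) d (g * mat_adjoint g) $$ (i, j) =
      (complex_of_real (1 / real d) \<cdot>\<^sub>m (A * mat_adjoint A)) $$ (i, j)"
    using A i j by (simp del: index_mult_mat(1))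
qed (use A in \<open>auto simp: partial_trace_def\<close>)

text \<open>Only the dimensions and the number of rounds enter, so one algorithm serves all
  projectors and all block encodings.\<close>

definition amplification_algorithm :: "nat \<Rightarrow> nat \<Rightarrow> nat \<Rightarrow> query_algorithm" where
  "amplification_algorithm d a k =
    (let \<phi> = entangled_state d (2 ^ a * d); M = ancilla_zero d a; n = d * 2 ^ a * d in
      \<lparr>ref_dim = d, init_state = \<phi> * mat_adjoint \<phi>,
       program = amplification_program (Fixed_Unitary (reflection n (1\<^sub>m n - kron M (1\<^sub>m d))))
         (Fixed_Unitary (reflection n (\<phi> * mat_adjoint \<phi>))) k,
       meas_success = M, meas_failure = 1\<^sub>m (d * 2 ^ a) - M\<rparr>)"

lemma kron_ancilla_zero_projector:
  fixes w a d :: nat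
  defines "Q \<equiv> kron (ancilla_zero w a) (1\<^sub>m d)"
  shows "Q \<in> carrier_mat (w * 2 ^ a * d) (w * 2 ^ a * d)" "mat_adjoint Q = Q" "Q * Q = Q"
proof -
  note M = ancilla_zero_projector[of w a]
  show "Q \<in> carrier_mat (w * 2 ^ a * d) (w * 2 ^ a * d)"
    unfolding Q_def using M(1) by (intro kron_carrier) auto
  show "mat_adjoint Q = Q"
    by (simp add: Q_def mat_adjoint_kron M(2))
  show "Q * Q = Q"
    unfolding Q_def using kron_mult[OF M(1) M(1) one_carrier_mat one_carrier_mat, of d] by (simp add: M(3))
qed

lemma wf_amplification_algorithm:
  assumes "0 < d"
  shows "wf_algorithm d a (amplification_algorithm d a k)"
proof -
  let ?n = "d * 2 ^ a * d" and ?\<phi> = "entangled_state d (2 ^ a * d)"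
  let ?M = "ancilla_zero d a" and ?m = "d * 2 ^ a"
  note M = ancilla_zero_projector[of d a] and Q = kron_ancilla_zero_projector[of d a d]
  have \<phi>: "?\<phi> \<in> carrier_mat ?n 1"
    using entangled_state_carrier[of d "2 ^ a * d"] by (simp add: mult.assoc)
  have norm: "mat_adjoint ?\<phi> * ?\<phi> = 1\<^sub>m 1"
    using assms by (intro entangled_state_norm) auto
  have dens: "density_operator ?n (?\<phi> * mat_adjoint ?\<phi>)"
    by (rule density_operator_pure[OF \<phi> norm])
  \<comment> \<open>Idempotence of the projector onto the unit vector \<phi>, needed for the
    reflection to be unitary.\<close>
  have "?\<phi> * mat_adjoint ?\<phi> * (?\<phi> * mat_adjoint ?\<phi>) = ?\<phi> * (mat_adjoint ?\<phi> * (?\<phi> * mat_adjoint ?\<phi>))"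
    by (rule assoc_mult_mat[OF \<phi> mat_adjoint_carrier[OF \<phi>] mult_carrier_mat[OF \<phi> mat_adjoint_carrier[OF \<phi>]]])
  also have "mat_adjoint ?\<phi> * (?\<phi> * mat_adjoint ?\<phi>) = mat_adjoint ?\<phi>"
    using assoc_mult_mat[OF mat_adjoint_carrier[OF \<phi>] \<phi> mat_adjoint_carrier[OF \<phi>]]
      left_mult_one_mat[OF mat_adjoint_carrier[OF \<phi>]] by (simp add: norm)
  finally have "unitary_mat ?n (reflection ?n (?\<phi> * mat_adjoint ?\<phi>))"
    using dens by (intro unitary_reflection) (auto simp: density_operator_def)
  moreover have "unitary_mat ?n (reflection ?n (1\<^sub>m ?n - kron ?M (1\<^sub>m d)))"
    by (rule unitary_reflection) (rule complement_projector[OF Q])+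
  \<comment> \<open>Both measurement operators are projectors, so completeness reduces to
    \<open>M + (1 - M) = 1\<close>.\<close>
  moreover have "mat_adjoint ?M * ?M + mat_adjoint (1\<^sub>m ?m - ?M) * (1\<^sub>m ?m - ?M) = 1\<^sub>m ?m"
    using M(1) by (auto simp: M(2,3) complement_projector(2,3)[OF M] intro!: eq_matI)
  ultimately show ?thesis
    using assms M(1) dens complement_projector(1)[OF M]
    by (auto simp: wf_algorithm_def amplification_algorithm_def Let_def dest: set_amplification_program)
qed

text \<open>The measurement maps the amplified vector to a multiple of \<open>g\<close>, whatever
  \<open>k\<close> is. The number of rounds thus affects only the success probability, and
  normalising, possible once \<open>q\<close> is nonzero, always returns the reduced state of
  \<open>g\<close>.\<close>

lemma amplification_algorithm_output:
  fixes d r a k :: nat and \<alpha> :: real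
  defines "s \<equiv> 1 / (\<alpha> * sqrt (real r * real d))"
  defines "q \<equiv> ((fst (amplitudes s k) + snd (amplitudes s k)) * s)\<^sup>2"
  assumes r: "1 \<le> r" and \<alpha>: "0 < \<alpha>" and P: "projector d r P"
    and \<rho>: "\<rho> = complex_of_real (1 / real r) \<cdot>\<^sub>m P" and BE: "block_encoding d \<alpha> a \<rho> U" and d: "0 < d"
  shows "s \<le> 1" "success_prob d (amplification_algorithm d a k) U = q"
    "q \<noteq> 0 \<Longrightarrow> output_state d a (amplification_algorithm d a k) U = \<rho>"
proof -
  define n where "n = 2 ^ a * d"
  define N where "N = d * 2 ^ a * d"
  define Q where "Q = kron (ancilla_zero d a) (1\<^sub>m d)"
  define W where "W = kron (1\<^sub>m d) U"
  define \<phi> where "\<phi> = entangled_state d n"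
  define \<psi> where "\<psi> = W * \<phi>"
  define g where "g = Q * \<psi>"
  have Nn: "N = d * n"
    by (simp add: N_def n_def mult.assoc)
  have Pc: "P \<in> carrier_mat d d" and Ph: "mat_adjoint P = P" and PP: "P * P = P" and rank: "vec_space.rank d P = r"
    using P by (auto simp: projector_def)
  have U: "unitary_mat n U"
    using BE by (simp add: block_encoding_def n_def)
  then have Uc: "U \<in> carrier_mat n n"
    by (simp add: unitary_mat_def)
  have W: "unitary_mat N W"
    unfolding W_def Nn by (rule unitary_mat_kron_one[OF U])
  have Wc: "W \<in> carrier_mat N N" and WW: "mat_adjoint W * W = 1\<^sub>m N"
    using W by (auto simp: unitary_mat_def)
  have Qc: "Q \<in> carrier_mat N N" and Qh: "mat_adjoint Q = Q" and QQ: "Q * Q = Q"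
    unfolding Q_def N_def by (rule kron_ancilla_zero_projector)+
  have \<phi>c: "\<phi> \<in> carrier_mat N 1"
    unfolding \<phi>_def Nn by (rule entangled_state_carrier)
  have \<psi>c: "\<psi> \<in> carrier_mat N 1"
    unfolding \<psi>_def by (rule mult_carrier_mat[OF Wc \<phi>c])
  have gc: "g \<in> carrier_mat N 1"
    unfolding g_def by (rule mult_carrier_mat[OF Qc \<psi>c])
  have ggc: "g * mat_adjoint g \<in> carrier_mat N N"
    by (rule mult_carrier_mat[OF gc mat_adjoint_carrier[OF gc]])
  have Qg: "Q * g = g"
    using assoc_mult_mat[OF Qc Qc \<psi>c] by (simp add: g_def QQ)

  have "mat_adjoint \<psi> * \<psi> = mat_adjoint \<phi> * (mat_adjoint W * \<psi>)"
    unfolding \<psi>_def mat_adjoint_mult[OF Wc \<phi>c]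
    by (rule assoc_mult_mat[OF mat_adjoint_carrier[OF \<phi>c] mat_adjoint_carrier[OF Wc] mult_carrier_mat[OF Wc \<phi>c]])
  also have "mat_adjoint W * \<psi> = \<phi>"
    using assoc_mult_mat[OF mat_adjoint_carrier[OF Wc] Wc \<phi>c] left_mult_one_mat[OF \<phi>c] by (simp add: \<psi>_def WW)
  finally have norm: "mat_adjoint \<psi> * \<psi> = 1\<^sub>m 1"
    using entangled_state_norm[OF d, of n] by (simp add: \<phi>_def n_def)

  \<comment> \<open>\<open>A\<close> is \<rho> divided by \<alpha>, the upper left block of
    \<open>U\<close>.\<close>
  define A where "A = complex_of_real (1 / (\<alpha> * real r)) \<cdot>\<^sub>m P"
  have Ac: "A \<in> carrier_mat d d"
    using Pc by (simp add: A_def)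
  have "U $$ (i, j) = A $$ (i, j)" if "i < d" "j < d" for i j
  proof -
    have "complex_of_real \<alpha> * U $$ (i, j) = complex_of_real \<alpha> * A $$ (i, j)"
      using block_encoding_index[OF BE that] that Pc \<alpha> by (simp add: \<rho> A_def)
    then show ?thesis
      using \<alpha> by simp
  qed
  then have "partial_trace (d * 2 ^ a) d (g * mat_adjoint g) = complex_of_real (1 / real d) \<cdot>\<^sub>m (A * mat_adjoint A)"
    using d Uc Ac unfolding n_def
    by (intro partial_trace_block_encoded[where U = U]) (auto simp: g_def Q_def \<psi>_def W_def \<phi>_def n_def)
  also have "mat_adjoint A = A"
  proof -
    have "cnj (P $$ (j, i)) = P $$ (i, j)" if "i < d" "j < d" for i j
      using that Pc Ph by (metis carrier_matD index_mat_adjoint)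
    then show ?thesis
      using Pc unfolding A_def by (intro eq_matI) auto
  qed
  also have "A * A = ((complex_of_real (1 / (\<alpha> * real r)))\<^sup>2) \<cdot>\<^sub>m P"
    using mult_smult_assoc_mat[OF Pc Ac, of "complex_of_real (1 / (\<alpha> * real r))"]
      mult_smult_distrib[OF Pc Pc, of "complex_of_real (1 / (\<alpha> * real r))"]
    by (simp add: A_def PP smult_smult_assoc_mat power2_eq_square)
  finally have "partial_trace (d * 2 ^ a) d (g * mat_adjoint g) =
      complex_of_real (1 / real d) \<cdot>\<^sub>m ((complex_of_real (1 / (\<alpha> * real r)))\<^sup>2 \<cdot>\<^sub>m P)" .
  \<comment> \<open>Both sides equal \<open>1 / (\<alpha>\<^sup>2 * r\<^sup>2 * d)\<close>;
    splitting off \<open>1 / r\<close> exhibits the reduced state of \<open>g\<close> as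
    \<open>s\<^sup>2\<close> times \<rho>.\<close>
  moreover have "1 / real d * (1 / (\<alpha> * real r))\<^sup>2 = s\<^sup>2 / real r"
    using r by (simp add: s_def power_divide power_mult_distrib power2_eq_square)
  then have "complex_of_real (1 / real d) * (complex_of_real (1 / (\<alpha> * real r)))\<^sup>2 = complex_of_real (s\<^sup>2 / real r)"
    by (simp only: flip: of_real_mult of_real_power)
  ultimately have pt: "partial_trace (d * 2 ^ a) d (g * mat_adjoint g) = complex_of_real (s\<^sup>2 / real r) \<cdot>\<^sub>m P"
    by (simp only: smult_smult_assoc_mat)
  have tr_P: "tr P = of_nat r"
    using tr_idempotent[OF Pc PP] by (simp add: rank)
  have "tr (g * mat_adjoint g) = tr (complex_of_real (s\<^sup>2 / real r) \<cdot>\<^sub>m P)"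
    using tr_partial_trace[of "g * mat_adjoint g" "d * 2 ^ a" d] ggc by (simp add: N_def pt)
  also have "\<dots> = complex_of_real (s\<^sup>2 / real r) * tr P"
    by (rule tr_smult[OF Pc])
  also have "\<dots> = complex_of_real (s\<^sup>2)"
    using r by (simp add: tr_P)
  finally have tr_gg: "tr (g * mat_adjoint g) = complex_of_real (s\<^sup>2)" .

  have gg: "mat_adjoint g * g = complex_of_real (s\<^sup>2) \<cdot>\<^sub>m 1\<^sub>m 1"
  proof -
    have "tr (mat_adjoint g * g) = (mat_adjoint g * g) $$ (0, 0)"
      using gc by (simp add: tr_def del: index_mult_mat(1))
    then have "(mat_adjoint g * g) $$ (0, 0) = complex_of_real (s\<^sup>2)"
      using tr_mult_commute[OF gc mat_adjoint_carrier[OF gc]] tr_gg by simp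
    then show ?thesis
      using gc by (intro eq_matI) (auto simp del: index_mult_mat(1))
  qed
  \<comment> \<open>As \<open>Q\<close> is a projector, the overlap of \<psi> and \<open>g\<close>
    equals the squared norm of \<open>g\<close>.\<close>
  have "mat_adjoint g * g = mat_adjoint \<psi> * (Q * g)"
    unfolding g_def mat_adjoint_mult[OF Qc \<psi>c] Qh
    by (rule assoc_mult_mat[OF mat_adjoint_carrier[OF \<psi>c] Qc mult_carrier_mat[OF Qc \<psi>c]])
  then have \<psi>g: "mat_adjoint \<psi> * g = complex_of_real (s\<^sup>2) \<cdot>\<^sub>m 1\<^sub>m 1"
    by (simp add: Qg gg)

  have g_sum: "s\<^sup>2 = (\<Sum>l<N. (cmod (g $$ (l, 0)))\<^sup>2)"
  proof -
    have "(mat_adjoint g * g) $$ (0, 0) = complex_of_real (\<Sum>l<N. (cmod (g $$ (l, 0)))\<^sup>2)"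
      unfolding adjoint_mult_self[OF gc] by simp
    then have "complex_of_real (s\<^sup>2) = complex_of_real (\<Sum>l<N. (cmod (g $$ (l, 0)))\<^sup>2)"
      unfolding gg by simp
    then show ?thesis
      by (simp only: of_real_eq_iff)
  qed
  have \<psi>_sum: "1 = (\<Sum>l<N. (cmod (\<psi> $$ (l, 0)))\<^sup>2)"
  proof -
    have "(mat_adjoint \<psi> * \<psi>) $$ (0, 0) = complex_of_real (\<Sum>l<N. (cmod (\<psi> $$ (l, 0)))\<^sup>2)"
      unfolding adjoint_mult_self[OF \<psi>c] by simp
    then have "complex_of_real 1 = complex_of_real (\<Sum>l<N. (cmod (\<psi> $$ (l, 0)))\<^sup>2)"
      unfolding norm by simp
    then show ?thesis
      by (simp only: of_real_eq_iff)
  qed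
  \<comment> \<open>\<open>Q\<close> keeps or erases each entry of the unit vector \<psi>.\<close>
  have "s\<^sup>2 \<le> 1"
    unfolding g_sum \<psi>_sum
  proof (intro sum_mono)
    fix l assume "l \<in> {..<N}"
    then show "(cmod (g $$ (l, 0)))\<^sup>2 \<le> (cmod (\<psi> $$ (l, 0)))\<^sup>2"
      using kron_ancilla_zero_mult[of \<psi> d a d l] \<psi>c by (simp add: g_def Q_def N_def)
  qed
  then show "s \<le> 1"
    by (simp add: abs_square_le_1 abs_le_iff)

  \<comment> \<open>\<open>Q\<close> sends both \<psi> and \<open>g\<close> to \<open>g\<close>, so
    the two coordinates add up.\<close>
  define b where "b = fst (amplitudes s k) + snd (amplitudes s k)"
  define x where "x = complex_of_real (fst (amplitudes s k)) \<cdot>\<^sub>m \<psi> + complex_of_real (snd (amplitudes s k)) \<cdot>\<^sub>m g"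
  have xc: "x \<in> carrier_mat N 1"
    unfolding x_def by (intro add_carrier_mat smult_carrier_mat gc)
  have "final_state (amplification_algorithm d a k) U = x * mat_adjoint x"
    using amplification_program_state[OF U Nn \<phi>c Qc QQ, of \<psi> g s x k] norm \<psi>g
    by (simp add: final_state_def amplification_algorithm_def Let_def x_def \<psi>_def W_def g_def
        \<phi>_def n_def N_def Q_def)
  then have "success_branch d (amplification_algorithm d a k) U = unitary_channel Q (x * mat_adjoint x)"
    by (simp add: success_branch_def unitary_channel_def amplification_algorithm_def Let_def Q_def)
  also have "\<dots> = Q * x * mat_adjoint (Q * x)"
    by (rule unitary_channel_pure[OF Qc xc])
  also have "Q * x = complex_of_real b \<cdot>\<^sub>m g"
  proof -
    have "Q * x = complex_of_real (fst (amplitudes s k)) \<cdot>\<^sub>m g + complex_of_real (snd (amplitudes s k)) \<cdot>\<^sub>m g"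
      unfolding x_def using \<psi>c gc
      by (subst mult_add_distrib_mat[OF Qc]) (auto simp: mult_smult_distrib[OF Qc \<psi>c] mult_smult_distrib[OF Qc gc] Qg g_def[symmetric])
    then show ?thesis
      using gc by (auto simp: b_def distrib_right intro!: eq_matI)
  qed
  also have "complex_of_real b \<cdot>\<^sub>m g * mat_adjoint (complex_of_real b \<cdot>\<^sub>m g) = complex_of_real (b\<^sup>2) \<cdot>\<^sub>m (g * mat_adjoint g)"
  proof -
    have "mat_adjoint (complex_of_real b \<cdot>\<^sub>m g) = complex_of_real b \<cdot>\<^sub>m mat_adjoint g"
      by (intro eq_matI) auto
    then show ?thesis
      using mult_smult_assoc_mat[OF gc smult_carrier_mat[OF mat_adjoint_carrier[OF gc]]]
        mult_smult_distrib[OF gc mat_adjoint_carrier[OF gc]]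
      by (simp add: smult_smult_assoc_mat power2_eq_square)
  qed
  finally have sb: "success_branch d (amplification_algorithm d a k) U = complex_of_real (b\<^sup>2) \<cdot>\<^sub>m (g * mat_adjoint g)" .
  have "tr (complex_of_real (b\<^sup>2) \<cdot>\<^sub>m (g * mat_adjoint g)) = complex_of_real (b\<^sup>2) * tr (g * mat_adjoint g)"
    by (rule tr_smult[OF ggc])
  then show sp: "success_prob d (amplification_algorithm d a k) U = q"
    by (simp add: success_prob_def sb tr_gg q_def b_def power_mult_distrib flip: of_real_mult of_real_power)
  assume "q \<noteq> 0"
  \<comment> \<open>The factor \<open>b\<^sup>2 * s\<^sup>2\<close> is exactly \<open>q\<close> and
    cancels.\<close>
  then have "1 / q * (b\<^sup>2 * (s\<^sup>2 / real r)) = 1 / real r"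
    by (simp add: q_def b_def power_mult_distrib)
  moreover have "ref_dim (amplification_algorithm d a k) = d"
    by (simp add: amplification_algorithm_def Let_def)
  ultimately show "output_state d a (amplification_algorithm d a k) U = \<rho>"
    using ggc unfolding output_state_def sp sb \<rho> N_def
    by (simp add: partial_trace_smult pt smult_smult_assoc_mat mult.assoc del: of_real_divide of_real_mult of_real_power flip: of_real_mult)
qed

section \<open>Choice of the number of rounds and conclusion\<close>

theorem corollary5:
  shows "\<exists>C::real. \<exists>p::real. C > 0 \<and> p > 0 \<and>
    (\<forall>(r::nat) (d::nat) (a::nat) (\<alpha>::real) (\<epsilon>::real).
      1 \<le> r \<and> r \<le> d \<and> 0 < a \<and> 0 < \<alpha> \<and> 0 < \<epsilon> \<and> \<epsilon> < 1 \<longrightarrow>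
      (\<exists>alg. wf_algorithm d a alg \<and>
        (\<forall>P \<rho> U. projector d r P \<and> \<rho> = complex_of_real (1 / real r) \<cdot>\<^sub>m P \<and>
            block_encoding d \<alpha> a \<rho> U \<longrightarrow>
          real (num_queries alg) \<le> C * \<alpha> * sqrt (real r * real d) \<and>
          success_prob d alg U \<ge> p \<and>
          trace_norm (output_state d a alg U - \<rho>) \<le> \<epsilon>)))"
\<comment> \<open>Both constants come from \<open>amplification_rounds\<close>: \<open>3 / s\<close>
  is \<open>3 * \<alpha> * sqrt (r * d)\<close>, and 1/2 bounds the squared good amplitude.\<close>
proof (rule exI[of _ 3], rule exI[of _ "1 / 2"], intro conjI allI impI)
  fix r d a :: nat and \<alpha> \<epsilon> :: real
  assume "1 \<le> r \<and> r \<le> d \<and> 0 < a \<and> 0 < \<alpha> \<and> 0 < \<epsilon> \<and> \<epsilon> < 1"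
  then have r: "1 \<le> r" and d: "0 < d" and \<alpha>: "0 < \<alpha>" and \<epsilon>: "0 < \<epsilon>"
    by auto
  define s where "s = 1 / (\<alpha> * sqrt (real r * real d))"
  have "0 < s"
    using r d \<alpha> by (simp add: s_def)
  \<comment> \<open>If \<open>s > 1\<close>, no block encoding exists, but the algorithm must still be well-formed.\<close>
  then have "\<exists>k. s \<le> 1 \<longrightarrow> 2 * real k + 1 \<le> 3 / s \<and>
      1 / 2 \<le> ((fst (amplitudes s k) + snd (amplitudes s k)) * s)\<^sup>2"
    using amplification_rounds[of s] by blast
  then obtain k where k: "s \<le> 1 \<Longrightarrow> 2 * real k + 1 \<le> 3 / s"
    "s \<le> 1 \<Longrightarrow> 1 / 2 \<le> ((fst (amplitudes s k) + snd (amplitudes s k)) * s)\<^sup>2"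
    by blast
  let ?alg = "amplification_algorithm d a k"
  show "\<exists>alg. wf_algorithm d a alg \<and>
      (\<forall>P \<rho> U. projector d r P \<and> \<rho> = complex_of_real (1 / real r) \<cdot>\<^sub>m P \<and> block_encoding d \<alpha> a \<rho> U \<longrightarrow>
        real (num_queries alg) \<le> 3 * \<alpha> * sqrt (real r * real d) \<and>
        success_prob d alg U \<ge> 1 / 2 \<and> trace_norm (output_state d a alg U - \<rho>) \<le> \<epsilon>)"
  proof (intro exI[of _ ?alg] conjI allI impI wf_amplification_algorithm[OF d])
    fix P \<rho> U
    assume "projector d r P \<and> \<rho> = complex_of_real (1 / real r) \<cdot>\<^sub>m P \<and> block_encoding d \<alpha> a \<rho> U"
    then have P: "projector d r P" and \<rho>: "\<rho> = complex_of_real (1 / real r) \<cdot>\<^sub>m P"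
      and BE: "block_encoding d \<alpha> a \<rho> U"
      by auto
    note out = amplification_algorithm_output(2,3)[OF r \<alpha> P \<rho> BE d, of k, folded s_def]
    note k = k[OF amplification_algorithm_output(1)[OF r \<alpha> P \<rho> BE d, folded s_def]]
    have "num_queries ?alg = 2 * k + 1"
      by (simp add: amplification_algorithm_def Let_def num_queries_amplification)
    then show "real (num_queries ?alg) \<le> 3 * \<alpha> * sqrt (real r * real d)"
      using k(1) by (simp add: s_def mult.assoc)
    show "1 / 2 \<le> success_prob d ?alg U"
      using k(2) by (simp add: out(1))
    \<comment> \<open>The success probability is at least 1/2, hence nonzero, and the output is
      exact.\<close>
    have "output_state d a ?alg U = \<rho>"
      using k(2) by (intro out(2)) auto
    moreover have "\<rho> \<in> carrier_mat d d"
      using P by (simp add: \<rho> projector_def)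
    ultimately show "trace_norm (output_state d a ?alg U - \<rho>) \<le> \<epsilon>"
      using \<epsilon> by (simp add: minus_r_inv_mat)
  qed
qed auto

end
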